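(* Let $e:\mathbb R\to[0,\infty]$ and $v:\mathbb R\to(-\infty,\infty]$ be functions related by $e(x)=v(x)-x$, $v(x)=x+e(x)$. Then the properties (i) $e$ is closed convex; $e(0)=0$ and $e(x)\ge0$ for all $x$; $e(a)>0$ and $e(b)>0$ for some $a<0<b$ are equivalent to the properties (ii) $v$ is closed convex; $v(0)=0$ and $v(x)\ge x$ for all $x$; $v(a)>a$ and $v(b)>b$ for some $a<0<b$, and they ensure that the functionals on $\mathcal L^p$ $$\mathcal V(X)=\mathbb E[v(X)],\qquad \mathcal E(X)=\mathbb E[e(X)]$$ form a corresponding pair (i.e. $\mathcal V(X)=\mathcal E(X)+\mathbb E[X]$) consisting of a subregular measure of regret and a subregular measure of error. For $X\in V:=\operatorname{dom}\mathcal V=\operatorname{dom}\mathcal E$ let $C^+(X)=\sup\{C\mid X-C\in V\}$ and $C^-(X)=\inf\{C\mid X-C\in V\}$. The associated statistic $\mathcal S$ in the quadrangle generated from $\mathcal V$ and $\mathcal E$ is characterized then by $$\mathcal S(X)=\{C\mid \mathbb E[e'_-(X-C)]\le0\le\mathbb E[e'_+(X-C)]\}=\{C\mid\mathbb E[v'_-(X-C)]\le1\le\mathbb E[v'_+(X-C)]\},$$ subject to the modification that, in both cases, the right side (the expectation involving $e'_+$, resp. $v'_+$) is replaced by $\infty$ if $C\le C^-(X)$ and the left side (the expectation involving $e'_-$, resp. $v'_-$) is replaced by $-\infty$ if $C\ge C^+(X)$. The quadrangle is completed then by setting $$\mathcal D(X)=\mathbb E[e(X-C)]\quad\text{and}\quad\mathcal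 R(X)=C+\mathbb E[v(X-C)]\quad\text{for any/all } C\in\mathcal S(X).$$ Having $\mathcal V$ and $\mathcal R$ be monotone corresponds (in tandem with convexity) to having $v(x)\le0$ when $x<0$, or equivalently $e(x)\le|x|$ when $x<0$. Positive homogeneity holds in the quadrangle if and only if $v$ and $e$ have graphs composed of two linear pieces linked at $0$.
   Context: Let $(\Omega,\mathcal M,\mathbb P)$ be a probability space. For $p\in[1,\infty]$, $\mathcal L^p=\mathcal L^p(\Omega,\mathcal M,\mathbb P)$ is the normed space of random variables (identified when equal almost surely) with $\|X\|_p<\infty$. Constants are identified with constant random variables. A functional is closed if all its sublevel sets $\{\mathcal F\le C\}$, $C\in\mathbb R$, are closed. It is monotone if $\mathcal F(X)\le\mathcal F(Y)$ whenever $X\le Y$ almost surely, and positively homogeneous if $\mathcal F(\lambda X)=\lambda\mathcal F(X)$ for all $\lambda>0$. $\operatorname{dom}\mathcal F=\{X:\mathcal F(X)<\infty\}$. A subregular measure of regret is a closed convex $\mathcal V:\mathcal L^p\to(-\infty,\infty]$ such that $\mathcal V(0)=0$, $\mathcal V(X)\ge\mathbb E[X]$ for all $X$, and for every non-zero $X$ there is $\lambda>0$ with $\mathcal V(\lambda X)>\mathbb E[\lambda X]$. A subregular measure of error is a closed convex $\mathcal E:\mathcal L^p\to[0,\infty]$ such that $\mathcal E(0)=0$, and for every non-zero $X$ there is $\lambda>0$ with $\mathcal E(\lambda X)>0$. The quadrangle generated from a corresponding pair $\mathcal V,\mathcal E$ is $(\mathcal R,\mathcal D,\mathcal V,\mathcal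 E)$ with $\mathcal D(X)=\min_C\mathcal E(X-C)$, $\mathcal R(X)=\min_C\{C+\mathcal V(X-C)\}=\mathcal D(X)+\mathbb E[X]$, and statistic $\mathcal S(X)=\operatorname{argmin}_C\mathcal E(X-C)=\operatorname{argmin}_C\{C+\mathcal V(X-C)\}$. Positive homogeneity in the quadrangle means that its functionals are positively homogeneous. $e'_-,e'_+$ (and $v'_-,v'_+$) denote the left and right derivatives of the closed convex function $e$ (resp. $v$), with the usual convention that both equal $+\infty$ at points to the right of the effective domain and $-\infty$ at points to the left of it, and with the right (left) derivative equal to $+\infty$ ($-\infty$) at a right (left) endpoint belonging to the effective domain. A "linear piece" on an open half-line ending at $0$ may have infinite slope, i.e. the function may be $+\infty$ there. *)

theory Defs
  imports "HOL-Probability.Probability"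
begin

section \<open>The spaces $L^p$, $1 \le p \le \infty$\<close>

text \<open>
  Random variables are represented by measurable functions rather than by classes modulo
  almost sure equality. The topology on them is the one of the seminorm, and functionals on the
  quotient are functionals on representatives that respect almost sure equality.
\<close>

definition Lp_norm :: "'a measure \<Rightarrow> ennreal \<Rightarrow> ('a \<Rightarrow> real) \<Rightarrow> ereal" where
  "Lp_norm M p X =
     (if p = \<infinity> then esssup M (\<lambda>\<omega>. ereal \<bar>X \<omega>\<bar>)
      else let I = (\<integral>\<^sup>+ \<omega>. ennreal (\<bar>X \<omega>\<bar> powr enn2real p) \<partial>M)
           in if I = \<infinity> then \<infinity> else ereal (enn2real I powr (1 / enn2real p)))"

definition Lp :: "'a measure \<Rightarrow> ennreal \<Rightarrow> ('a \<Rightarrow> real) set" where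
  "Lp M p = {X \<in> borel_measurable M. Lp_norm M p X < \<infinity>}"

definition Lp_topology :: "'a measure \<Rightarrow> ennreal \<Rightarrow> ('a \<Rightarrow> real) topology" where
  "Lp_topology M p = topology (\<lambda>U. U \<subseteq> Lp M p \<and>
     (\<forall>X\<in>U. \<exists>r>0. \<forall>Y\<in>Lp M p. Lp_norm M p (\<lambda>\<omega>. Y \<omega> - X \<omega>) < ereal r \<longrightarrow> Y \<in> U))"

lemma openin_Lp_topology:
  "openin (Lp_topology M p) U \<longleftrightarrow> U \<subseteq> Lp M p \<and>
     (\<forall>X\<in>U. \<exists>r>0. \<forall>Y\<in>Lp M p. Lp_norm M p (\<lambda>\<omega>. Y \<omega> - X \<omega>) < ereal r \<longrightarrow> Y \<in> U)"
proof -
  let ?P = "\<lambda>U. U \<subseteq> Lp M p \<and>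
     (\<forall>X\<in>U. \<exists>r>0. \<forall>Y\<in>Lp M p. Lp_norm M p (\<lambda>\<omega>. Y \<omega> - X \<omega>) < ereal r \<longrightarrow> Y \<in> U)"
  have "istopology ?P"
    unfolding istopology_def
  proof (intro conjI allI impI)
    fix S T assume S: "?P S" and T: "?P T"
    show "S \<inter> T \<subseteq> Lp M p" using S by blast
    show "\<forall>X\<in>S \<inter> T. \<exists>r>0. \<forall>Y\<in>Lp M p. Lp_norm M p (\<lambda>\<omega>. Y \<omega> - X \<omega>) < ereal r \<longrightarrow> Y \<in> S \<inter> T"
    proof
      fix X assume X: "X \<in> S \<inter> T"
      obtain r where r: "r > 0" "\<forall>Y\<in>Lp M p. Lp_norm M p (\<lambda>\<omega>. Y \<omega> - X \<omega>) < ereal r \<longrightarrow> Y \<in> S"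
        using S X by blast
      obtain s where s: "s > 0" "\<forall>Y\<in>Lp M p. Lp_norm M p (\<lambda>\<omega>. Y \<omega> - X \<omega>) < ereal s \<longrightarrow> Y \<in> T"
        using T X by blast
      have "Y \<in> S \<inter> T" if "Y \<in> Lp M p" "Lp_norm M p (\<lambda>\<omega>. Y \<omega> - X \<omega>) < ereal (min r s)" for Y
      proof -
        have "Lp_norm M p (\<lambda>\<omega>. Y \<omega> - X \<omega>) < ereal r" "Lp_norm M p (\<lambda>\<omega>. Y \<omega> - X \<omega>) < ereal s"
          using that(2) by (auto elim: less_le_trans)
        then show ?thesis using r s that(1) by blast
      qed
      then show "\<exists>r>0. \<forall>Y\<in>Lp M p. Lp_norm M p (\<lambda>\<omega>. Y \<omega> - X \<omega>) < ereal r \<longrightarrow> Y \<in> S \<inter> T"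
        using r(1) s(1) by (intro exI[of _ "min r s"]) auto
    qed
  next
    fix K assume K: "\<forall>U\<in>K. ?P U"
    show "\<Union>K \<subseteq> Lp M p" using K by blast
    show "\<forall>X\<in>\<Union>K. \<exists>r>0. \<forall>Y\<in>Lp M p. Lp_norm M p (\<lambda>\<omega>. Y \<omega> - X \<omega>) < ereal r \<longrightarrow> Y \<in> \<Union>K"
      using K by (meson UnionE UnionI)
  qed
  then show ?thesis by (simp add: Lp_topology_def topology_inverse')
qed

section \<open>Functionals on $L^p$\<close>

definition respects_AE :: "'a measure \<Rightarrow> ennreal \<Rightarrow> (('a \<Rightarrow> real) \<Rightarrow> ereal) \<Rightarrow> bool" where
  "respects_AE M p F \<longleftrightarrow>
     (\<forall>X\<in>Lp M p. \<forall>Y\<in>Lp M p. (AE \<omega> in M. X \<omega> = Y \<omega>) \<longrightarrow> F X = F Y)"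

definition closed_functional :: "'a measure \<Rightarrow> ennreal \<Rightarrow> (('a \<Rightarrow> real) \<Rightarrow> ereal) \<Rightarrow> bool" where
  "closed_functional M p F \<longleftrightarrow>
     (\<forall>C::real. closedin (Lp_topology M p) {X \<in> Lp M p. F X \<le> ereal C})"

definition convex_functional :: "'a measure \<Rightarrow> ennreal \<Rightarrow> (('a \<Rightarrow> real) \<Rightarrow> ereal) \<Rightarrow> bool" where
  "convex_functional M p F \<longleftrightarrow>
     (\<forall>X\<in>Lp M p. \<forall>Y\<in>Lp M p. \<forall>t. 0 < t \<and> t < 1 \<longrightarrow>
        F (\<lambda>\<omega>. (1 - t) * X \<omega> + t * Y \<omega>) \<le> ereal (1 - t) * F X + ereal t * F Y)"

definition monotone_functional :: "'a measure \<Rightarrow> ennreal \<Rightarrow> (('a \<Rightarrow> real) \<Rightarrow> ereal) \<Rightarrow> bool" where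
  "monotone_functional M p F \<longleftrightarrow>
     (\<forall>X\<in>Lp M p. \<forall>Y\<in>Lp M p. (AE \<omega> in M. X \<omega> \<le> Y \<omega>) \<longrightarrow> F X \<le> F Y)"

definition pos_homogeneous :: "'a measure \<Rightarrow> ennreal \<Rightarrow> (('a \<Rightarrow> real) \<Rightarrow> ereal) \<Rightarrow> bool" where
  "pos_homogeneous M p F \<longleftrightarrow>
     (\<forall>X\<in>Lp M p. \<forall>c>0. F (\<lambda>\<omega>. c * X \<omega>) = ereal c * F X)"

definition dom_functional ::
    "'a measure \<Rightarrow> ennreal \<Rightarrow> (('a \<Rightarrow> real) \<Rightarrow> ereal) \<Rightarrow> ('a \<Rightarrow> real) set" where
  "dom_functional M p F = {X \<in> Lp M p. F X < \<infinity>}"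

definition subregular_regret :: "'a measure \<Rightarrow> ennreal \<Rightarrow> (('a \<Rightarrow> real) \<Rightarrow> ereal) \<Rightarrow> bool" where
  "subregular_regret M p V \<longleftrightarrow>
     respects_AE M p V \<and> (\<forall>X\<in>Lp M p. V X \<noteq> -\<infinity>) \<and>
     closed_functional M p V \<and> convex_functional M p V \<and>
     V (\<lambda>_. 0) = 0 \<and>
     (\<forall>X\<in>Lp M p. ereal (integral\<^sup>L M X) \<le> V X) \<and>
     (\<forall>X\<in>Lp M p. \<not> (AE \<omega> in M. X \<omega> = 0) \<longrightarrow>
        (\<exists>c>0. ereal (integral\<^sup>L M (\<lambda>\<omega>. c * X \<omega>)) < V (\<lambda>\<omega>. c * X \<omega>)))"

definition subregular_error :: "'a measure \<Rightarrow> ennreal \<Rightarrow> (('a \<Rightarrow> real) \<Rightarrow> ereal) \<Rightarrow> bool" where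
  "subregular_error M p E \<longleftrightarrow>
     respects_AE M p E \<and> (\<forall>X\<in>Lp M p. 0 \<le> E X) \<and>
     closed_functional M p E \<and> convex_functional M p E \<and>
     E (\<lambda>_. 0) = 0 \<and>
     (\<forall>X\<in>Lp M p. \<not> (AE \<omega> in M. X \<omega> = 0) \<longrightarrow> (\<exists>c>0. 0 < E (\<lambda>\<omega>. c * X \<omega>)))"

definition corresponding_pair ::
    "'a measure \<Rightarrow> ennreal \<Rightarrow> (('a \<Rightarrow> real) \<Rightarrow> ereal) \<Rightarrow> (('a \<Rightarrow> real) \<Rightarrow> ereal) \<Rightarrow> bool" where
  "corresponding_pair M p V E \<longleftrightarrow> (\<forall>X\<in>Lp M p. V X = E X + ereal (integral\<^sup>L M X))"

section \<open>The quadrangle generated from a pair\<close>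

definition argmin :: "(real \<Rightarrow> ereal) \<Rightarrow> real set" where
  "argmin f = {C. is_arg_min f (\<lambda>_. True) C}"

text \<open>
  Deviation and risk are infima here; that they are minima amounts to the corresponding
  \<^term>\<open>argmin\<close> being nonempty.
\<close>

definition deviation_of :: "(('a \<Rightarrow> real) \<Rightarrow> ereal) \<Rightarrow> ('a \<Rightarrow> real) \<Rightarrow> ereal" where
  "deviation_of E X = (INF C::real. E (\<lambda>\<omega>. X \<omega> - C))"

definition risk_of :: "(('a \<Rightarrow> real) \<Rightarrow> ereal) \<Rightarrow> ('a \<Rightarrow> real) \<Rightarrow> ereal" where
  "risk_of V X = (INF C::real. ereal C + V (\<lambda>\<omega>. X \<omega> - C))"

definition statistic_of :: "(('a \<Rightarrow> real) \<Rightarrow> ereal) \<Rightarrow> ('a \<Rightarrow> real) \<Rightarrow> real set" where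
  "statistic_of E X = argmin (\<lambda>C. E (\<lambda>\<omega>. X \<omega> - C))"

definition C_plus ::
    "'a measure \<Rightarrow> ennreal \<Rightarrow> (('a \<Rightarrow> real) \<Rightarrow> ereal) \<Rightarrow> ('a \<Rightarrow> real) \<Rightarrow> ereal" where
  "C_plus M p V X = Sup {ereal C | C. (\<lambda>\<omega>. X \<omega> - C) \<in> dom_functional M p V}"

definition C_minus ::
    "'a measure \<Rightarrow> ennreal \<Rightarrow> (('a \<Rightarrow> real) \<Rightarrow> ereal) \<Rightarrow> ('a \<Rightarrow> real) \<Rightarrow> ereal" where
  "C_minus M p V X = Inf {ereal C | C. (\<lambda>\<omega>. X \<omega> - C) \<in> dom_functional M p V}"

section \<open>Extended-real-valued functions on the line\<close>

definition closed_fun :: "(real \<Rightarrow> ereal) \<Rightarrow> bool" where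
  "closed_fun f \<longleftrightarrow> (\<forall>C::real. closed {x. f x \<le> ereal C})"

definition convex_fun :: "(real \<Rightarrow> ereal) \<Rightarrow> bool" where
  "convex_fun f \<longleftrightarrow>
     (\<forall>x y t. 0 < t \<and> t < 1 \<longrightarrow>
        f ((1 - t) * x + t * y) \<le> ereal (1 - t) * f x + ereal t * f y)"

text \<open>
  One-sided derivatives of a closed convex function that is nowhere \<open>-\<infinity>\<close>. The difference
  quotient already yields \<open>\<infinity>\<close> for the right derivative at a right endpoint of the effective
  domain and \<open>-\<infinity>\<close> for the left derivative at a left endpoint, so only points outside the
  domain need a separate clause.
\<close>

definition right_deriv :: "(real \<Rightarrow> ereal) \<Rightarrow> real \<Rightarrow> ereal" where
  "right_deriv f x =
     (if f x < \<infinity> then Lim (at_right x) (\<lambda>y. (f y - f x) / ereal (y - x))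
      else if \<forall>y. f y < \<infinity> \<longrightarrow> y < x then \<infinity> else -\<infinity>)"

definition left_deriv :: "(real \<Rightarrow> ereal) \<Rightarrow> real \<Rightarrow> ereal" where
  "left_deriv f x =
     (if f x < \<infinity> then Lim (at_left x) (\<lambda>y. (f y - f x) / ereal (y - x))
      else if \<forall>y. f y < \<infinity> \<longrightarrow> y < x then \<infinity> else -\<infinity>)"

text \<open>
  An infinite slope \<open>a = -\<infinity>\<close> or \<open>b = \<infinity>\<close> makes the function \<open>\<infinity>\<close> on the respective open
  half-line; the opposite infinite slopes are excluded for functions that are nowhere \<open>-\<infinity>\<close>.
\<close>

definition two_linear_pieces :: "(real \<Rightarrow> ereal) \<Rightarrow> bool" where
  "two_linear_pieces f \<longleftrightarrow>
     f 0 = 0 \<and>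
     (\<exists>a b :: ereal. (\<forall>x<0. f x = a * ereal x) \<and> (\<forall>x>0. f x = b * ereal x))"

text \<open>
  Expectation of an extended-real-valued random variable: the integral of the positive part minus
  that of the negative part, where \<open>\<infinity> - \<infinity> = \<infinity>\<close> in \<^typ>\<open>ereal\<close>.
\<close>

definition ext_expectation :: "'a measure \<Rightarrow> ('a \<Rightarrow> ereal) \<Rightarrow> ereal" where
  "ext_expectation M f =
     enn2ereal (\<integral>\<^sup>+ \<omega>. e2ennreal (f \<omega>) \<partial>M) - enn2ereal (\<integral>\<^sup>+ \<omega>. e2ennreal (- f \<omega>) \<partial>M)"

end

theory Submission
  imports Defs
begin

text \<open>
  For fixed \<open>X\<close> the function \<open>\<phi>(C) = E[e(X - C)]\<close> is convex, is closed by Fatou's lemma, and is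
  coercive because \<open>e\<close> grows at least linearly; hence it attains its minimum. Integrating the
  supporting-line inequality \<open>e(x) \<le> e(x - h) + h e'\<^sub>-(x)\<close> in one direction, and passing to the limit
  in the monotone difference quotients by Fatou's lemma in the other, shows that \<open>E[e'\<^sub>-(X - C)] \<le> 0\<close>
  holds exactly if \<open>\<phi>(C) \<le> \<phi>(C')\<close> for all \<open>C' > C\<close>, provided that \<open>\<phi>\<close> is finite somewhere to the
  right of \<open>C\<close>. The condition on \<open>e'\<^sub>+\<close> is the mirror image, obtained from \<open>x \<mapsto> e(-x)\<close> and \<open>-X\<close>.
  Everything about \<open>v\<close> follows from the identity \<open>\<V>(X) = \<E>(X) + E[X]\<close>.
\<close>


subsection \<open>Extended expectations\<close>

text \<open>Two conventions shape the argument. \<open>ext_expectation\<close> sets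
  \<open>\<infinity> - \<infinity> = \<infinity>\<close>, so it need not change sign with its
  integrand. Reflection therefore yields the condition on \<open>right_deriv e\<close> only once the
  positive part of \<open>right_deriv e (X - C)\<close> is known to have finite integral, and a
  finite expected error at some \<open>C1 < C\<close> supplies this. A finite value at some
  \<open>C1 > C\<close> likewise supplies the integrable minorant that Fatou's lemma needs, since
  difference quotients may have either sign. If no such \<open>C1\<close> exists, comparing
  \<open>C\<close> with the points on that side is vacuous, and this is exactly the case that the
  replacement at \<open>C_plus\<close> or \<open>C_minus\<close> declares satisfied. Closedness of
  the functionals is reduced to almost sure convergence for all p at once: convergence in the L^p
  seminorm implies convergence in L^1, hence almost surely along a subsequence. The Fatou argument
  for a sequence of constants thus also serves on L^p.\<close>

lemma ext_expectation_nonneg: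
  assumes "AE \<omega> in M. 0 \<le> f \<omega>"
  shows "ext_expectation M f = enn2ereal (\<integral>\<^sup>+ \<omega>. e2ennreal (f \<omega>) \<partial>M)"
proof -
  have "AE \<omega> in M. e2ennreal (- f \<omega>) = 0"
    using assms by eventually_elim (auto intro!: e2ennreal_neg)
  then have "(\<integral>\<^sup>+ \<omega>. e2ennreal (- f \<omega>) \<partial>M) = (\<integral>\<^sup>+ \<omega>. 0 \<partial>M)"
    by (intro nn_integral_cong_AE)
  then show ?thesis
    by (simp add: ext_expectation_def zero_ennreal.rep_eq)
qed

lemma ext_expectation_mono_AE:
  assumes "AE \<omega> in M. f \<omega> \<le> g \<omega>"
  shows "ext_expectation M f \<le> ext_expectation M g"
  unfolding ext_expectation_def
proof (intro ereal_minus_mono)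
  show "enn2ereal (\<integral>\<^sup>+ \<omega>. e2ennreal (f \<omega>) \<partial>M) \<le> enn2ereal (\<integral>\<^sup>+ \<omega>. e2ennreal (g \<omega>) \<partial>M)"
    unfolding less_eq_ennreal.rep_eq[symmetric]
    by (intro nn_integral_mono_AE) (use assms in \<open>eventually_elim, auto intro: e2ennreal_mono\<close>)
  show "enn2ereal (\<integral>\<^sup>+ \<omega>. e2ennreal (- g \<omega>) \<partial>M) \<le> enn2ereal (\<integral>\<^sup>+ \<omega>. e2ennreal (- f \<omega>) \<partial>M)"
    unfolding less_eq_ennreal.rep_eq[symmetric]
    by (intro nn_integral_mono_AE) (use assms in \<open>eventually_elim, auto intro: e2ennreal_mono\<close>)
qed

lemma ext_expectation_cong_AE:
  assumes "AE \<omega> in M. f \<omega> = g \<omega>"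
  shows "ext_expectation M f = ext_expectation M g"
proof (rule antisym)
  show "ext_expectation M f \<le> ext_expectation M g"
    by (rule ext_expectation_mono_AE) (use assms in eventually_elim, simp)
  show "ext_expectation M g \<le> ext_expectation M f"
    by (rule ext_expectation_mono_AE) (use assms in eventually_elim, simp)
qed

lemma ext_expectation_integrable:
  assumes "integrable M f"
  shows "ext_expectation M (\<lambda>\<omega>. ereal (f \<omega>)) = ereal (integral\<^sup>L M f)"
proof -
  have "(\<integral>\<^sup>+ \<omega>. ennreal (f \<omega>) \<partial>M) \<noteq> \<infinity>" "(\<integral>\<^sup>+ \<omega>. ennreal (- f \<omega>) \<partial>M) \<noteq> \<infinity>"
    using assms by (auto simp: real_integrable_def)
  then show ?thesis
    unfolding ext_expectation_def real_lebesgue_integral_def[OF assms]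
    by (cases "\<integral>\<^sup>+ \<omega>. ennreal (f \<omega>) \<partial>M"; cases "\<integral>\<^sup>+ \<omega>. ennreal (- f \<omega>) \<partial>M") auto
qed

lemma ext_expectation_cmult:
  assumes [measurable]: "f \<in> borel_measurable M" and c: "0 < c"
  shows "ext_expectation M (\<lambda>\<omega>. ereal c * f \<omega>) = ereal c * ext_expectation M f"
proof -
  have *: "e2ennreal (ereal c * x) = ennreal c * e2ennreal x" for x
    using c by (cases x) (auto simp: e2ennreal_neg ennreal_mult' ennreal_mult_top simp flip: infinity_ereal_def)
  have **: "e2ennreal (- (ereal c * x)) = ennreal c * e2ennreal (- x)" for x
    using *[of "-x"] by simp
  have ***: "enn2ereal (ennreal c * I) = ereal c * enn2ereal I" for I
    using c by (simp add: times_ennreal.rep_eq)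
  have "ereal c * x - ereal c * y = ereal c * (x - y)" for x y
    using c by (cases x; cases y) (auto simp: algebra_simps)
  then show ?thesis
    unfolding ext_expectation_def * ** by (simp add: nn_integral_cmult ***)
qed

text \<open>If both parts of \<open>f\<close> had infinite integral, the convention would give
  \<open>\<infinity>\<close> for \<open>f\<close> and for \<open>- f\<close> alike; the hypothesis
  rules this out.\<close>

lemma ext_expectation_uminus:
  assumes "(\<integral>\<^sup>+ \<omega>. e2ennreal (f \<omega>) \<partial>M) \<noteq> \<infinity>"
  shows "ext_expectation M (\<lambda>\<omega>. - f \<omega>) = - ext_expectation M f"
  using assms unfolding ext_expectation_def ereal_uminus_uminus
  by (cases "\<integral>\<^sup>+ \<omega>. e2ennreal (f \<omega>) \<partial>M"; cases "\<integral>\<^sup>+ \<omega>. e2ennreal (- f \<omega>) \<partial>M") auto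

text \<open>Subtraction is postponed to the end: the sum of \<open>(f + g)^+\<close>,
  \<open>f^-\<close>, \<open>g^-\<close> equals the sum of \<open>(f + g)^-\<close>,
  \<open>f^+\<close>, \<open>g^+\<close> pointwise, even where \<open>f\<close> is infinite, and
  this integrates to an identity in \<open>ennreal\<close>.\<close>

lemma ext_expectation_add_integrable:
  assumes [measurable]: "f \<in> borel_measurable M" and g: "integrable M g"
  shows "ext_expectation M (\<lambda>\<omega>. f \<omega> + ereal (g \<omega>)) = ext_expectation M f + ereal (integral\<^sup>L M g)"
proof -
  have [measurable]: "g \<in> borel_measurable M" using g by auto
  define P where "P = (\<integral>\<^sup>+ \<omega>. e2ennreal (f \<omega>) \<partial>M)"
  define N where "N = (\<integral>\<^sup>+ \<omega>. e2ennreal (- f \<omega>) \<partial>M)"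
  define A where "A = (\<integral>\<^sup>+ \<omega>. ennreal (g \<omega>) \<partial>M)"
  define B where "B = (\<integral>\<^sup>+ \<omega>. ennreal (- g \<omega>) \<partial>M)"
  define P' where "P' = (\<integral>\<^sup>+ \<omega>. e2ennreal (f \<omega> + ereal (g \<omega>)) \<partial>M)"
  define N' where "N' = (\<integral>\<^sup>+ \<omega>. e2ennreal (- (f \<omega> + ereal (g \<omega>))) \<partial>M)"
  have fin: "A \<noteq> \<infinity>" "B \<noteq> \<infinity>"
    using g by (auto simp: real_integrable_def A_def B_def)
  have int: "integral\<^sup>L M g = enn2real A - enn2real B"
    unfolding real_lebesgue_integral_def[OF g] A_def B_def ..
  have pointwise: "e2ennreal (x + ereal y) + e2ennreal (- x) + ennreal (- y)
      = e2ennreal (- (x + ereal y)) + e2ennreal x + ennreal y" for x y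
  proof (cases x)
    case (real r)
    then show ?thesis
      by (cases "0 \<le> r"; cases "0 \<le> y"; cases "0 \<le> r + y")
        (auto simp: ennreal_neg simp flip: ennreal_plus)
  qed auto
  have eq: "P' + N + B = N' + P + A"
    unfolding P'_def N_def B_def N'_def P_def A_def
    by (simp add: nn_integral_add[symmetric] pointwise)
  have b1: "e2ennreal (x + ereal y) \<le> e2ennreal x + ennreal y" for x y
    by (cases x) (auto simp: ennreal_plus_if intro!: ennreal_leI)
  have b2: "e2ennreal (- (x + ereal y)) \<le> e2ennreal (- x) + ennreal (- y)" for x y
    by (cases x) (auto simp: ennreal_plus_if intro!: ennreal_leI)
  have b3: "e2ennreal x \<le> e2ennreal (x + ereal y) + ennreal (- y)" for x y
    by (cases x) (auto simp: ennreal_plus_if intro!: ennreal_leI)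
  have b4: "e2ennreal (- x) \<le> e2ennreal (- (x + ereal y)) + ennreal y" for x y
    by (cases x) (auto simp: ennreal_plus_if intro!: ennreal_leI)
  have bounds: "P' \<le> P + A" "N' \<le> N + B" "P \<le> P' + B" "N \<le> N' + A"
    unfolding P'_def N_def B_def N'_def P_def A_def
    by (simp_all add: nn_integral_add[symmetric] nn_integral_mono b1 b2 b3 b4)
  \<comment> \<open>Since \<open>A\<close> and \<open>B\<close> are finite, the bounds make
    \<open>P\<close> and \<open>P'\<close> infinite together, and likewise \<open>N\<close> and
    \<open>N'\<close>. When all are finite, \<open>eq\<close> can be solved for the
    difference.\<close>
  have "enn2ereal P' - enn2ereal N' = enn2ereal P - enn2ereal N + ereal (enn2real A - enn2real B)"
  proof (cases "P = \<infinity>")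
    case True
    then have "P' = \<infinity>"
      using bounds(3) fin by (auto simp: top_unique)
    then show ?thesis using True by simp
  next
    case P: False
    then have P': "P' \<noteq> \<infinity>"
      using bounds(1) fin by (auto simp: top_unique)
    show ?thesis
    proof (cases "N = \<infinity>")
      case True
      then have "N' = \<infinity>"
        using bounds(4) fin by (auto simp: top_unique)
      then show ?thesis using True P P' by (cases P; cases P') auto
    next
      case N: False
      then have N': "N' \<noteq> \<infinity>"
        using bounds(2) fin by (auto simp: top_unique)
      show ?thesis
        using P N P' N' fin eq
        by (cases P; cases N; cases P'; cases N'; cases A; cases B)
          (auto simp flip: ennreal_plus)
    qed
  qed
  then show ?thesis
    unfolding ext_expectation_def int P'_def N'_def P_def N_def .
qed

lemma ext_expectation_add_integrable':
  assumes "f \<in> borel_measurable M" and "integrable M g"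
  shows "ext_expectation M (\<lambda>\<omega>. ereal (g \<omega>) + f \<omega>) = ereal (integral\<^sup>L M g) + ext_expectation M f"
  using ext_expectation_add_integrable[OF assms] by (simp add: add.commute)

lemma ext_expectation_add_nonneg:
  assumes [measurable]: "f \<in> borel_measurable M" "g \<in> borel_measurable M"
    and "\<And>\<omega>. 0 \<le> f \<omega>" "\<And>\<omega>. 0 \<le> g \<omega>"
  shows "ext_expectation M (\<lambda>\<omega>. f \<omega> + g \<omega>) = ext_expectation M f + ext_expectation M g"
proof -
  have "e2ennreal (x + y) = e2ennreal x + e2ennreal y" if "0 \<le> x" "0 \<le> y" for x y
    using that by (cases x; cases y) auto
  then show ?thesis
    using assms(3,4) by (simp add: ext_expectation_nonneg nn_integral_add plus_ennreal.rep_eq)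
qed

subsection \<open>Membership in $L^p$\<close>

text \<open>A substitute for Jensen's inequality: splitting at \<open>\<bar>X\<bar> = a\<close> costs only the factor 2.\<close>

lemma (in prob_space) nn_integral_abs_le_of_Lp_norm:
  assumes p: "1 \<le> p" and [measurable]: "X \<in> borel_measurable M" and a: "0 < a"
    and norm: "Lp_norm M p X \<le> ereal a"
  shows "(\<integral>\<^sup>+ \<omega>. ennreal \<bar>X \<omega>\<bar> \<partial>M) \<le> ennreal (2 * a)"
proof (cases "p = \<infinity>")
  case True
  have "AE \<omega> in M. ereal \<bar>X \<omega>\<bar> \<le> esssup M (\<lambda>\<omega>. ereal \<bar>X \<omega>\<bar>)"
    by (rule esssup_AE)
  then have "AE \<omega> in M. ennreal \<bar>X \<omega>\<bar> \<le> ennreal (2 * a)"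
  proof eventually_elim
    case (elim \<omega>)
    also have "esssup M (\<lambda>\<omega>. ereal \<bar>X \<omega>\<bar>) \<le> ereal a"
      using norm True by (simp add: Lp_norm_def)
    finally have "ereal \<bar>X \<omega>\<bar> \<le> ereal a" .
    then show ?case using a by (intro ennreal_leI) simp
  qed
  then have "(\<integral>\<^sup>+ \<omega>. ennreal \<bar>X \<omega>\<bar> \<partial>M) \<le> (\<integral>\<^sup>+ \<omega>. ennreal (2 * a) \<partial>M)"
    by (rule nn_integral_mono_AE)
  then show ?thesis by (simp add: emeasure_space_1)
next
  case False
  define q where "q = enn2real p"
  have q: "1 \<le> q"
    using p False unfolding q_def by (cases p) (auto simp flip: ennreal_1)
  define I where "I = (\<integral>\<^sup>+ \<omega>. ennreal (\<bar>X \<omega>\<bar> powr q) \<partial>M)"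
  have I: "I \<noteq> \<infinity>" and "enn2real I powr (1 / q) \<le> a"
    using norm False by (auto simp: Lp_norm_def Let_def I_def q_def split: if_splits)
  then have "(enn2real I powr (1 / q)) powr q \<le> a powr q"
    using q by (intro powr_mono2) auto
  then have Ia: "I \<le> ennreal (a powr q)"
    using I q by (cases I) (auto simp: powr_powr intro!: ennreal_leI)
  \<comment> \<open>Beyond \<open>a\<close>, split off the factor
    \<open>\<bar>z\<bar> powr (1 - q)\<close>, whose exponent is not positive. Its bound
    \<open>a powr (1 - q)\<close> is the weight that makes the second term integrate to at most
    \<open>a\<close>.\<close>
  have bound: "\<bar>z\<bar> \<le> a + a powr (1 - q) * \<bar>z\<bar> powr q" for z
  proof (cases "\<bar>z\<bar> \<le> a")
    case True
    then show ?thesis by (intro order_trans[OF True]) simp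
  next
    case False
    then have "\<bar>z\<bar> powr (1 - q) \<le> a powr (1 - q)"
      using a q by (intro powr_mono2') auto
    then have "\<bar>z\<bar> powr q * \<bar>z\<bar> powr (1 - q) \<le> \<bar>z\<bar> powr q * a powr (1 - q)"
      by (intro mult_left_mono) auto
    moreover have "\<bar>z\<bar> powr q * \<bar>z\<bar> powr (1 - q) = \<bar>z\<bar>"
      using False a by (simp flip: powr_add)
    ultimately show ?thesis using a by (simp add: mult.commute)
  qed
  have "(\<integral>\<^sup>+ \<omega>. ennreal \<bar>X \<omega>\<bar> \<partial>M)
      \<le> (\<integral>\<^sup>+ \<omega>. ennreal a + ennreal (a powr (1 - q)) * ennreal (\<bar>X \<omega>\<bar> powr q) \<partial>M)"
    using bound a
    by (intro nn_integral_mono)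
      (auto simp flip: ennreal_plus ennreal_mult intro!: ennreal_leI)
  also have "\<dots> = ennreal a + ennreal (a powr (1 - q)) * I"
    by (simp add: nn_integral_add nn_integral_cmult I_def emeasure_space_1)
  also have "\<dots> \<le> ennreal a + ennreal (a powr (1 - q)) * ennreal (a powr q)"
    using Ia by (intro add_left_mono mult_left_mono) auto
  also have "\<dots> = ennreal (2 * a)"
    using a by (simp flip: ennreal_plus ennreal_mult powr_add)
  finally show ?thesis .
qed

lemma (in prob_space) integrable_Lp:
  assumes "1 \<le> p" and X: "X \<in> Lp M p"
  shows "integrable M X"
proof -
  have [measurable]: "X \<in> borel_measurable M" and "Lp_norm M p X < \<infinity>"
    using X by (auto simp: Lp_def)
  then obtain b where "Lp_norm M p X \<le> ereal b"
    by (cases "Lp_norm M p X") auto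
  \<comment> \<open>The estimate to be applied asks for a positive bound, which \<open>b\<close>
    need not be.\<close>
  then have "Lp_norm M p X \<le> ereal (max b 1)"
    by (rule order_trans) simp
  from nn_integral_abs_le_of_Lp_norm[OF \<open>1 \<le> p\<close> _ _ this]
  show ?thesis
    by (auto simp: less_max_iff_disj integrable_iff_bounded top_unique less_top[symmetric])
qed

lemma Lp_finite_iff:
  assumes "p \<noteq> \<infinity>"
  shows "X \<in> Lp M p \<longleftrightarrow>
    X \<in> borel_measurable M \<and> (\<integral>\<^sup>+ \<omega>. ennreal (\<bar>X \<omega>\<bar> powr enn2real p) \<partial>M) \<noteq> \<infinity>"
  using assms by (auto simp: Lp_def Lp_norm_def Let_def)

lemma Lp_infinity_iff:
  "X \<in> Lp M top \<longleftrightarrow> X \<in> borel_measurable M \<and> (\<exists>K. AE \<omega> in M. \<bar>X \<omega>\<bar> \<le> K)"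
proof (intro iffI conjI)
  assume X: "X \<in> Lp M top"
  then show "X \<in> borel_measurable M" by (simp add: Lp_def)
  have "esssup M (\<lambda>\<omega>. ereal \<bar>X \<omega>\<bar>) < \<infinity>"
    using X by (simp add: Lp_def Lp_norm_def)
  then obtain K where K: "esssup M (\<lambda>\<omega>. ereal \<bar>X \<omega>\<bar>) \<le> ereal K"
    by (cases "esssup M (\<lambda>\<omega>. ereal \<bar>X \<omega>\<bar>)") auto
  have "AE \<omega> in M. ereal \<bar>X \<omega>\<bar> \<le> esssup M (\<lambda>\<omega>. ereal \<bar>X \<omega>\<bar>)"
    by (rule esssup_AE)
  then have "AE \<omega> in M. \<bar>X \<omega>\<bar> \<le> K"
    by eventually_elim (use K in \<open>auto dest: order_trans\<close>)
  then show "\<exists>K. AE \<omega> in M. \<bar>X \<omega>\<bar> \<le> K" ..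
next
  assume "X \<in> borel_measurable M \<and> (\<exists>K. AE \<omega> in M. \<bar>X \<omega>\<bar> \<le> K)"
  then obtain K where [measurable]: "X \<in> borel_measurable M" and K: "AE \<omega> in M. \<bar>X \<omega>\<bar> \<le> K"
    by blast
  have "esssup M (\<lambda>\<omega>. ereal \<bar>X \<omega>\<bar>) \<le> ereal K"
    using K by (intro esssup_I) auto
  then show "X \<in> Lp M top"
    by (auto simp: Lp_def Lp_norm_def)
qed

lemma (in prob_space) const_Lp: "(\<lambda>_. c) \<in> Lp M p"
  by (cases "p = \<infinity>") (auto simp: Lp_finite_iff Lp_infinity_iff emeasure_space_1)

lemma (in prob_space) Lp_diff_const:
  assumes "1 \<le> p" and X: "X \<in> Lp M p"
  shows "(\<lambda>\<omega>. X \<omega> - c) \<in> Lp M p"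
proof (cases "p = \<infinity>")
  case True
  then obtain K where [measurable]: "X \<in> borel_measurable M" and K: "AE \<omega> in M. \<bar>X \<omega>\<bar> \<le> K"
    using X by (auto simp: Lp_infinity_iff)
  have "AE \<omega> in M. \<bar>X \<omega> - c\<bar> \<le> K + \<bar>c\<bar>"
    using K by eventually_elim simp
  then show ?thesis by (auto simp: True Lp_infinity_iff)
next
  case False
  define q where "q = enn2real p"
  have q: "1 \<le> q"
    using \<open>1 \<le> p\<close> False unfolding q_def by (cases p) (auto simp flip: ennreal_1)
  have [measurable]: "X \<in> borel_measurable M"
    and fin: "(\<integral>\<^sup>+ \<omega>. ennreal (\<bar>X \<omega>\<bar> powr q) \<partial>M) \<noteq> \<infinity>"
    using X by (auto simp: Lp_finite_iff[OF False] q_def)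
  have bound: "\<bar>x - c\<bar> powr q \<le> 2 powr q * \<bar>x\<bar> powr q + 2 powr q * \<bar>c\<bar> powr q" for x
  proof -
    have "\<bar>x - c\<bar> powr q \<le> (2 * max \<bar>x\<bar> \<bar>c\<bar>) powr q"
      using q by (intro powr_mono2) auto
    also have "\<dots> = 2 powr q * max \<bar>x\<bar> \<bar>c\<bar> powr q"
      by (simp add: powr_mult)
    also have "\<dots> \<le> 2 powr q * (\<bar>x\<bar> powr q + \<bar>c\<bar> powr q)"
      by (intro mult_left_mono) (auto simp: max_def)
    finally show ?thesis by (simp add: distrib_left)
  qed
  have "(\<integral>\<^sup>+ \<omega>. ennreal (\<bar>X \<omega> - c\<bar> powr q) \<partial>M)
      \<le> (\<integral>\<^sup>+ \<omega>. ennreal (2 powr q) * ennreal (\<bar>X \<omega>\<bar> powr q) + ennreal (2 powr q * \<bar>c\<bar> powr q) \<partial>M)"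
    using bound
    by (intro nn_integral_mono)
      (auto simp flip: ennreal_plus ennreal_mult intro!: ennreal_leI)
  also have "\<dots> = ennreal (2 powr q) * (\<integral>\<^sup>+ \<omega>. ennreal (\<bar>X \<omega>\<bar> powr q) \<partial>M) + ennreal (2 powr q * \<bar>c\<bar> powr q)"
    by (simp add: nn_integral_add nn_integral_cmult emeasure_space_1)
  also have "\<dots> < \<infinity>"
    using fin by (simp add: ennreal_mult_less_top less_top)
  finally show ?thesis
    by (simp add: Lp_finite_iff[OF False] q_def)
qed

subsection \<open>Error integrands on the line\<close>

locale error_integrand =
  fixes e :: "real \<Rightarrow> ereal"
  assumes closed: "closed_fun e"
    and convex: "convex_fun e"
    and zero [simp]: "e 0 = 0"
    and nonneg [simp]: "0 \<le> e x"
    and pos_left: "\<exists>a<0. 0 < e a"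
    and pos_right: "\<exists>b>0. 0 < e b"
begin

lemma not_MInf [simp]: "e x \<noteq> -\<infinity>"
  using nonneg[of x] by auto

lemma finite_cases:
  obtains r where "e x = ereal r" "0 \<le> r" | "e x = \<infinity>"
  using nonneg[of x] by (cases "e x") auto

text \<open>The endpoints \<open>t = 0\<close> and \<open>t = 1\<close> are included because
  \<open>0 * \<infinity> = 0\<close> in \<open>ereal\<close>.\<close>

lemma convexD:
  assumes "0 \<le> t" "t \<le> 1"
  shows "e ((1 - t) * x + t * y) \<le> ereal (1 - t) * e x + ereal t * e y"
proof -
  consider "t = 0" | "t = 1" | "0 < t" "t < 1"
    using assms by linarith
  then show ?thesis
    using convex by cases (auto simp: convex_fun_def simp flip: zero_ereal_def one_ereal_def)
qed

lemma scale_le: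
  assumes "0 \<le> t" "t \<le> 1"
  shows "e (t * x) \<le> ereal t * e x"
  using convexD[OF assms, of 0 x] by simp

lemma mono_outward:
  assumes "0 \<le> x \<and> x \<le> y \<or> y \<le> x \<and> x \<le> 0"
  shows "e x \<le> e y"
proof (cases "y = 0")
  case False
  define t where "t = x / y"
  have t: "0 \<le> t" "t \<le> 1" "t * y = x"
    using assms False by (auto simp: t_def divide_simps)
  have "e x \<le> ereal t * e y"
    using scale_le[OF t(1,2), of y] t(3) by simp
  also have "\<dots> \<le> 1 * e y"
    using t by (intro ereal_mult_right_mono) auto
  finally show ?thesis by simp
qed (use assms in auto)

text \<open>Choose a real \<open>m > 0\<close> below \<open>e a\<close> and \<open>e b\<close>,
  which may be infinite, and let \<open>c\<close> be the larger of \<open>b\<close> and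
  \<open>- a\<close>. Then \<open>e\<close> is at least \<open>m\<close> at both \<open>c\<close>
  and \<open>- c\<close>. Scaling a point \<open>x\<close> with \<open>\<bar>x\<bar> > c\<close>
  back to one of them gives \<open>m \<le> (c / \<bar>x\<bar>) * e x\<close>, which is the slope
  \<open>m / c\<close>. Subtracting \<open>m\<close> makes the bound nonpositive for
  \<open>\<bar>x\<bar> \<le> c\<close>.\<close>

lemma growth:
  obtains k m where "0 < k" "\<And>x. ereal (k * \<bar>x\<bar> - m) \<le> e x"
proof -
  obtain a b where ab: "a < 0" "0 < b" "0 < e a" "0 < e b"
    using pos_left pos_right by blast
  then have "0 < min (e a) (e b)" by simp
  from ereal_dense2[OF this] obtain m where m: "0 < m" "ereal m \<le> e a" "ereal m \<le> e b"
    by (auto simp flip: zero_ereal_def)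
  define c where "c = max b (- a)"
  have c: "0 < c" using ab by (simp add: c_def)
  have "ereal (m / c * \<bar>x\<bar> - m) \<le> e x" for x
  proof (cases "\<bar>x\<bar> \<le> c")
    case True
    then have "m / c * \<bar>x\<bar> - m \<le> 0"
      using m c by (simp add: field_simps)
    then have "ereal (m / c * \<bar>x\<bar> - m) \<le> 0" by simp
    then show ?thesis using nonneg order_trans by blast
  next
    case False
    define t where "t = c / \<bar>x\<bar>"
    have t: "0 < t" "t \<le> 1" using False c by (auto simp: t_def)
    have "ereal m \<le> e (t * x)"
    proof (cases "0 < x")
      case True
      then have "t * x = c" by (simp add: t_def)
      then show ?thesis
        using m(3) mono_outward[of b "t * x"] ab by (auto simp: c_def)
    next
      case False
      then have "t * x = - c" using c \<open>\<not> \<bar>x\<bar> \<le> c\<close> by (simp add: t_def field_simps)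
      then show ?thesis
        using m(2) mono_outward[of a "t * x"] ab by (force simp: c_def intro: order_trans)
    qed
    also have "\<dots> \<le> ereal t * e x"
      using t by (intro scale_le) auto
    finally have *: "ereal m \<le> ereal t * e x" .
    show ?thesis
    proof (cases x rule: finite_cases)
      case (1 r)
      then have "m \<le> t * r" using * by simp
      then have "m * \<bar>x\<bar> \<le> c * r"
        using False c by (simp add: t_def field_simps)
      then have "m / c * \<bar>x\<bar> \<le> r"
        using c by (simp add: field_simps)
      then show ?thesis using 1 m by simp
    qed simp
  qed
  then show thesis using that[of "m / c" m] m c by simp
qed

lemma lsc:
  assumes "x \<longlonglongrightarrow> l"
  shows "e l \<le> liminf (\<lambda>n. e (x n))"
  unfolding le_Liminf_iff
proof (intro allI impI)
  fix y assume y: "y < e l"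
  show "\<forall>\<^sub>F n in sequentially. y < e (x n)"
  proof (cases y)
    case (real c)
    have "open (- {x. e x \<le> ereal c})"
      using closed by (auto simp: closed_fun_def)
    then have "\<forall>\<^sub>F n in sequentially. x n \<in> - {x. e x \<le> ereal c}"
      using assms y real by (intro topological_tendstoD) auto
    then show ?thesis by eventually_elim (auto simp: real not_le)
  next
    case PInf
    then show ?thesis using y by simp
  next
    case MInf
    have "- \<infinity> < e x" for x by (cases x rule: finite_cases) auto
    then show ?thesis using MInf by simp
  qed
qed

lemma borel_measurable [measurable]: "e \<in> borel_measurable borel"
proof (rule borel_measurableI_le)
  fix y
  show "{x \<in> space borel. e x \<le> y} \<in> sets borel"
  proof (cases y)
    case (real c)
    then show ?thesis using closed by (auto simp: closed_fun_def)
  qed (auto simp: not_MInf)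
qed

lemma reflect: "error_integrand (\<lambda>x. e (- x))"
proof
  have "{x. e (- x) \<le> ereal C} = uminus ` {x. e x \<le> ereal C}" for C
    by (force simp: image_iff intro: exI[of _ "- x" for x])
  then show "closed_fun (\<lambda>x. e (- x))"
    using closed by (simp add: closed_fun_def closed_negations)
  show "convex_fun (\<lambda>x. e (- x))"
    unfolding convex_fun_def
  proof (intro allI impI)
    fix x y t :: real assume t: "0 < t \<and> t < 1"
    show "e (- ((1 - t) * x + t * y)) \<le> ereal (1 - t) * e (- x) + ereal t * e (- y)"
      using convexD[of t "- x" "- y"] t by (simp add: algebra_simps)
  qed
  show "\<exists>a<0. 0 < e (- a)" using pos_right by (metis neg_less_0_iff_less minus_minus)
  show "\<exists>b>0. 0 < e (- b)" using pos_left by (metis neg_0_less_iff_less minus_minus)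
qed auto

section \<open>Chord slopes and one-sided derivatives\<close>

definition quot :: "real \<Rightarrow> real \<Rightarrow> ereal" where
  "quot x y = (e y - e x) / ereal (y - x)"

lemma quot_real:
  assumes "e x = ereal r" "e y = ereal s"
  shows "quot x y = ereal ((s - r) / (y - x))"
  using assms by (cases "y = x") (auto simp: quot_def)

lemma quot_MInf:
  assumes "e x < \<infinity>" "e y = \<infinity>" "y < x"
  shows "quot x y = -\<infinity>"
  using assms by (cases x rule: finite_cases) (auto simp: quot_def divide_ereal_def)

text \<open>The three-chord inequality. If \<open>y\<close> lies outside the domain, the slope is
  \<open>-\<infinity>\<close>, so monotonicity persists beyond the left endpoint of the
  domain.\<close>

lemma quot_mono:
  assumes fin: "e x < \<infinity>" and y: "y \<le> z" "z < x"
  shows "quot x y \<le> quot x z"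
proof (cases y rule: finite_cases)
  case 2
  then show ?thesis using quot_MInf[of x y] fin y by simp
next
  case (1 s)
  obtain r where r: "e x = ereal r"
    using fin by (cases x rule: finite_cases) auto
  \<comment> \<open>The weight of \<open>y\<close> when \<open>z\<close> is written as a convex
    combination of \<open>x\<close> and \<open>y\<close>.\<close>
  define t where "t = (x - z) / (x - y)"
  have tt: "t * (x - y) = x - z"
    using y by (simp add: t_def)
  then have "(1 - t) * x + t * y = z"
    by (simp add: algebra_simps)
  moreover have "0 < t" "t \<le> 1"
    using y by (auto simp: t_def)
  ultimately have t: "0 < t" "t \<le> 1" "(1 - t) * x + t * y = z"
    by auto
  have le: "e z \<le> ereal ((1 - t) * r + t * s)"
    using convexD[of t x y] t r 1 by simp
  then obtain q where q: "e z = ereal q"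
    by (cases z rule: finite_cases) auto
  have "q - r \<le> t * (s - r)"
    using le q by (simp add: algebra_simps)
  then have "t * (s - r) / (z - x) \<le> (q - r) / (z - x)"
    using y by (intro divide_right_mono_neg) auto
  also have "t * (s - r) / (z - x) = (s - r) / (y - x)"
  proof -
    have "z - x = t * (y - x)" using tt by (simp add: algebra_simps)
    then show ?thesis using t by simp
  qed
  finally show ?thesis
    by (simp add: quot_real[OF r 1(1)] quot_real[OF r q])
qed

text \<open>Chord slopes increase as \<open>y\<close> rises to \<open>x\<close>, so their limit
  exists in \<open>ereal\<close> and is their supremum; only then does \<open>Lim\<close> in the
  definition denote a genuine limit.\<close>

lemma left_deriv_SUP:
  assumes fin: "e x < \<infinity>"
  shows "(quot x \<longlongrightarrow> left_deriv e x) (at_left x)" and "left_deriv e x = (SUP y\<in>{..<x}. quot x y)"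
proof -
  have lim: "(quot x \<longlongrightarrow> (SUP y\<in>{..<x}. quot x y)) (at_left x)"
    using Lim_left_bound[of UNIV x "quot x" \<infinity>] quot_mono[OF fin] by auto
  moreover have "left_deriv e x = Lim (at_left x) (quot x)"
    using fin by (simp add: left_deriv_def quot_def[abs_def])
  ultimately show "left_deriv e x = (SUP y\<in>{..<x}. quot x y)"
    by (simp add: tendsto_Lim)
  with lim show "(quot x \<longlongrightarrow> left_deriv e x) (at_left x)" by simp
qed

lemma quot_le_left_deriv:
  assumes "e x < \<infinity>" "y < x"
  shows "quot x y \<le> left_deriv e x"
  unfolding left_deriv_SUP(2)[OF assms(1)] using assms(2) by (auto intro: SUP_upper)

lemma finite_between:
  assumes "e x < \<infinity>" "e y < \<infinity>" "x \<le> z" "z \<le> y"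
  shows "e z < \<infinity>"
proof -
  have "e z \<le> e x \<or> e z \<le> e y"
    using mono_outward[of z x] mono_outward[of z y] assms by (cases "0 \<le> z") auto
  then show ?thesis using assms by auto
qed

text \<open>The domain is an interval containing 0, so the sign of an exterior point tells on which
  side of the domain it lies.\<close>

lemma outside_dom_iff:
  assumes "e x = \<infinity>"
  shows "(\<forall>y. e y < \<infinity> \<longrightarrow> y < x) \<longleftrightarrow> 0 < x"
proof
  assume "\<forall>y. e y < \<infinity> \<longrightarrow> y < x"
  then show "0 < x" using zero by fastforce
next
  assume x: "0 < x"
  show "\<forall>y. e y < \<infinity> \<longrightarrow> y < x"
  proof (intro allI impI, rule ccontr)
    fix y assume y: "e y < \<infinity>" "\<not> y < x"
    then have "e x < \<infinity>" using finite_between[of 0 y x] x by simp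
    then show False using assms by simp
  qed
qed

lemma left_deriv_outside:
  "e x = \<infinity> \<Longrightarrow> left_deriv e x = (if 0 < x then \<infinity> else -\<infinity>)"
  unfolding left_deriv_def using outside_dom_iff[of x] by simp

lemma right_deriv_outside:
  "e x = \<infinity> \<Longrightarrow> right_deriv e x = (if 0 < x then \<infinity> else -\<infinity>)"
  unfolding right_deriv_def using outside_dom_iff[of x] by simp

lemma left_deriv_eq_PInf:
  assumes "e x = \<infinity>" "e y < \<infinity>" "y < x"
  shows "left_deriv e x = \<infinity>"
proof -
  have "0 < x"
  proof (rule ccontr)
    assume "\<not> 0 < x"
    then have "e x < \<infinity>"
      using finite_between[of y 0 x] assms by simp
    then show False using assms by simp
  qed
  then show ?thesis using assms by (simp add: left_deriv_outside)
qed

text \<open>For \<open>x\<close> outside the domain the inequality survives through the convention: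
  \<open>y < x\<close> places \<open>x\<close> to the right of the domain, where the left derivative
  is \<open>\<infinity>\<close>. Finiteness of \<open>e\<close> is thus required at \<open>y\<close>
  alone.\<close>

lemma le_left_deriv:
  assumes "e y < \<infinity>" "y < x"
  shows "e x \<le> e y + ereal (x - y) * left_deriv e x"
proof (cases x rule: finite_cases)
  case 2
  then have "left_deriv e x = \<infinity>" using left_deriv_eq_PInf assms by simp
  then show ?thesis using assms by simp
next
  case (1 r)
  obtain s where s: "e y = ereal s"
    using assms by (cases y rule: finite_cases) auto
  have "ereal (x - y) * quot x y \<le> ereal (x - y) * left_deriv e x"
    using quot_le_left_deriv[of x y] 1 assms by (intro ereal_mult_left_mono) auto
  then have "ereal s + ereal (x - y) * quot x y \<le> e y + ereal (x - y) * left_deriv e x"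
    unfolding s by (intro add_left_mono)
  moreover have "ereal s + ereal (x - y) * quot x y = e x"
    using assms(2) 1 by (simp add: quot_real[OF 1(1) s] field_simps)
  ultimately show ?thesis by simp
qed

lemma quot_sequence_tendsto:
  assumes "e x < \<infinity>" "h \<longlonglongrightarrow> 0" "\<And>n. 0 < h n"
  shows "(\<lambda>n. quot x (x - h n)) \<longlonglongrightarrow> left_deriv e x"
proof (rule filterlim_compose[OF left_deriv_SUP(1)[OF assms(1)]])
  have "(\<lambda>n. x - h n) \<longlonglongrightarrow> x - 0"
    by (intro tendsto_intros assms)
  then show "filterlim (\<lambda>n. x - h n) (at_left x) sequentially"
    using assms(3) by (auto simp: filterlim_at less_imp_neq[symmetric] intro!: always_eventually)
qed

lemma left_deriv_measurable [measurable]: "left_deriv e \<in> borel_measurable borel"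
proof -
  \<comment> \<open>On the domain the limit may be taken along the countable family of steps
    \<open>1 / Suc n\<close>, which turns it into a \<open>liminf\<close> of measurable
    functions.\<close>
  have "left_deriv e x = (if e x < \<infinity> then liminf (\<lambda>n. quot x (x - 1 / real (Suc n)))
      else if 0 < x then \<infinity> else -\<infinity>)" for x
  proof (cases "e x < \<infinity>")
    case True
    have "(\<lambda>n. quot x (x - 1 / real (Suc n))) \<longlonglongrightarrow> left_deriv e x"
      by (rule quot_sequence_tendsto[OF True]) (use LIMSEQ_inverse_real_of_nat in \<open>auto simp: inverse_eq_divide\<close>)
    then show ?thesis
      using True by (simp add: lim_imp_Liminf)
  qed (simp add: left_deriv_outside)
  then have "left_deriv e = (\<lambda>x. if e x < \<infinity> then liminf (\<lambda>n. quot x (x - 1 / real (Suc n)))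
      else if 0 < x then \<infinity> else -\<infinity>)"
    by blast
  moreover have "(\<lambda>x. if e x < \<infinity> then liminf (\<lambda>n. quot x (x - 1 / real (Suc n)))
      else if 0 < x then \<infinity> else -\<infinity>) \<in> borel_measurable borel"
    unfolding quot_def by measurable
  ultimately show ?thesis by simp
qed

lemma quot_at_right_tendsto:
  assumes "e x < \<infinity>"
  shows "((\<lambda>y. (e y - e x) / ereal (y - x)) \<longlongrightarrow> - left_deriv (\<lambda>x. e (- x)) (- x)) (at_right x)"
proof -
  interpret r: error_integrand "\<lambda>x. e (- x)" by (rule reflect)
  have "(r.quot (- x) \<longlongrightarrow> left_deriv (\<lambda>x. e (- x)) (- x)) (at_left (- x))"
    using r.left_deriv_SUP(1)[of "- x"] assms by simp
  then have "((\<lambda>y. r.quot (- x) (- y)) \<longlongrightarrow> left_deriv (\<lambda>x. e (- x)) (- x)) (at_right x)"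
    by (simp add: at_left_minus[of "- x"] filterlim_filtermap)
  then have "((\<lambda>y. - r.quot (- x) (- y)) \<longlongrightarrow> - left_deriv (\<lambda>x. e (- x)) (- x)) (at_right x)"
    by (rule tendsto_uminus_ereal)
  moreover have "\<forall>\<^sub>F y in at_right x. - r.quot (- x) (- y) = (e y - e x) / ereal (y - x)"
    unfolding eventually_at_filter
  proof (rule always_eventually, intro allI impI)
    fix y assume "y \<noteq> x"
    have "- (a / ereal (- c)) = a / ereal c" if "c \<noteq> 0" for a :: ereal and c :: real
      using that by (cases a) (auto simp: divide_ereal_def)
    from this[of "y - x" "e y - e x"] \<open>y \<noteq> x\<close>
    show "- r.quot (- x) (- y) = (e y - e x) / ereal (y - x)"
      by (simp add: r.quot_def)
  qed
  ultimately show ?thesis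
    by (rule Lim_transform_eventually)
qed

text \<open>Reflection reverses the sign of chord slopes and exchanges the two exterior sides, so
  facts on left derivatives carry over to right derivatives.\<close>

lemma right_deriv_eq: "right_deriv e x = - left_deriv (\<lambda>x. e (- x)) (- x)"
proof (cases "e x < \<infinity>")
  case True
  then show ?thesis
    using quot_at_right_tendsto by (simp add: right_deriv_def tendsto_Lim)
next
  case False
  interpret r: error_integrand "\<lambda>x. e (- x)" by (rule reflect)
  \<comment> \<open>Outside the domain both sides are decided by a sign test, and the two tests
    agree everywhere except at 0.\<close>
  have "x \<noteq> 0" using False by (intro notI) auto
  then show ?thesis
    using False r.left_deriv_outside[of "- x"] right_deriv_outside[of x] by auto
qed

lemma right_deriv_measurable [measurable]: "right_deriv e \<in> borel_measurable borel"
proof -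
  interpret r: error_integrand "\<lambda>x. e (- x)" by (rule reflect)
  have "(\<lambda>x. - left_deriv (\<lambda>x. e (- x)) (- x)) \<in> borel_measurable borel"
    by measurable
  then show ?thesis by (simp add: right_deriv_eq[abs_def])
qed

section \<open>Derivatives after adding the identity\<close>

lemma left_deriv_add_id: "left_deriv (\<lambda>x. ereal x + e x) x = left_deriv e x + 1"
proof (cases "e x < \<infinity>")
  case True
  have "((\<lambda>y. quot x y + 1) \<longlongrightarrow> left_deriv e x + 1) (at_left x)"
    by (intro tendsto_add_ereal_general left_deriv_SUP True tendsto_const) auto
  moreover have "\<forall>\<^sub>F y in at_left x. quot x y + 1 = ((ereal y + e y) - (ereal x + e x)) / ereal (y - x)"
    unfolding eventually_at_filter
  proof (rule always_eventually, intro allI impI)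
    fix y assume y: "y \<noteq> x" "y \<in> {..<x}"
    obtain r where r: "e x = ereal r" using True by (cases x rule: finite_cases) auto
    show "quot x y + 1 = ((ereal y + e y) - (ereal x + e x)) / ereal (y - x)"
    proof (cases y rule: finite_cases)
      case (1 s)
      then show ?thesis using y r by (simp add: quot_real[OF r 1(1)] one_ereal_def field_simps)
    next
      case 2
      then show ?thesis using y r by (simp add: quot_def divide_ereal_def)
    qed
  qed
  ultimately have "((\<lambda>y. ((ereal y + e y) - (ereal x + e x)) / ereal (y - x)) \<longlongrightarrow> left_deriv e x + 1) (at_left x)"
    by (rule Lim_transform_eventually)
  then show ?thesis
    using True by (simp add: left_deriv_def[of "\<lambda>x. ereal x + e x"] tendsto_Lim)
next
  case False
  \<comment> \<open>The two functions have the same domain, so outside it both derivatives take the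
    same infinite value, which absorbs the summand 1.\<close>
  have *: "(ereal y + e y = \<infinity>) = (e y = \<infinity>)" for y by (cases "e y") auto
  show ?thesis using False by (simp add: left_deriv_def *)
qed

lemma right_deriv_add_id: "right_deriv (\<lambda>x. ereal x + e x) x = right_deriv e x + 1"
proof (cases "e x < \<infinity>")
  case True
  have "((\<lambda>y. (e y - e x) / ereal (y - x)) \<longlongrightarrow> right_deriv e x) (at_right x)"
    using quot_at_right_tendsto[OF True] by (simp add: right_deriv_eq)
  then have "((\<lambda>y. (e y - e x) / ereal (y - x) + 1) \<longlongrightarrow> right_deriv e x + 1) (at_right x)"
    by (intro tendsto_add_ereal_general tendsto_const) auto
  moreover have "\<forall>\<^sub>F y in at_right x. (e y - e x) / ereal (y - x) + 1 = ((ereal y + e y) - (ereal x + e x)) / ereal (y - x)"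
    unfolding eventually_at_filter
  proof (rule always_eventually, intro allI impI)
    fix y assume y: "y \<noteq> x" "y \<in> {x<..}"
    obtain r where r: "e x = ereal r" using True by (cases x rule: finite_cases) auto
    show "(e y - e x) / ereal (y - x) + 1 = ((ereal y + e y) - (ereal x + e x)) / ereal (y - x)"
    proof (cases y rule: finite_cases)
      case (1 s)
      then show ?thesis using y r by (simp add: one_ereal_def field_simps)
    next
      case 2
      then show ?thesis using y r by (simp add: divide_ereal_def)
    qed
  qed
  ultimately have "((\<lambda>y. ((ereal y + e y) - (ereal x + e x)) / ereal (y - x)) \<longlongrightarrow> right_deriv e x + 1) (at_right x)"
    by (rule Lim_transform_eventually)
  then show ?thesis
    using True by (simp add: right_deriv_def[of "\<lambda>x. ereal x + e x"] tendsto_Lim)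
next
  case False
  have *: "(ereal y + e y = \<infinity>) = (e y = \<infinity>)" for y by (cases "e y") auto
  show ?thesis using False by (simp add: right_deriv_def *)
qed

end

subsection \<open>The expected error\<close>

locale expected_error = prob_space M + error_integrand e
  for M :: "'a measure" and e :: "real \<Rightarrow> ereal"
begin

definition err :: "('a \<Rightarrow> real) \<Rightarrow> ereal" where
  "err X = ext_expectation M (\<lambda>\<omega>. e (X \<omega>))"

lemma err_eq_nn_integral: "err X = enn2ereal (\<integral>\<^sup>+ \<omega>. e2ennreal (e (X \<omega>)) \<partial>M)"
  unfolding err_def by (intro ext_expectation_nonneg) simp

lemma err_nonneg [simp]: "0 \<le> err X"
  by (simp add: err_eq_nn_integral)

lemma err_cong_AE:
  assumes "AE \<omega> in M. X \<omega> = Y \<omega>"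
  shows "err X = err Y"
  unfolding err_def by (rule ext_expectation_cong_AE) (use assms in eventually_elim, simp)

lemma err_const: "err (\<lambda>_. c) = e c"
  by (simp add: err_eq_nn_integral emeasure_space_1 enn2ereal_e2ennreal)

lemma err_convex:
  assumes [measurable]: "X \<in> borel_measurable M" "Y \<in> borel_measurable M" and t: "0 < t" "t < 1"
  shows "err (\<lambda>\<omega>. (1 - t) * X \<omega> + t * Y \<omega>) \<le> ereal (1 - t) * err X + ereal t * err Y"
proof -
  have "err (\<lambda>\<omega>. (1 - t) * X \<omega> + t * Y \<omega>)
      \<le> ext_expectation M (\<lambda>\<omega>. ereal (1 - t) * e (X \<omega>) + ereal t * e (Y \<omega>))"
    unfolding err_def using t by (intro ext_expectation_mono_AE AE_I2 convexD) auto
  also have "\<dots> = ext_expectation M (\<lambda>\<omega>. ereal (1 - t) * e (X \<omega>)) + ext_expectation M (\<lambda>\<omega>. ereal t * e (Y \<omega>))"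
    using t by (intro ext_expectation_add_nonneg) auto
  also have "\<dots> = ereal (1 - t) * err X + ereal t * err Y"
    unfolding err_def using t by (simp add: ext_expectation_cmult)
  finally show ?thesis .
qed

text \<open>Lower semicontinuity of \<open>e\<close> transfers to \<open>err\<close> by Fatou's
  lemma. Almost sure convergence and an eventual bound suffice, so one statement covers shifts by
  converging constants and sequences in L^p.\<close>

lemma err_le_of_AE_tendsto:
  assumes [measurable]: "\<And>n. Y n \<in> borel_measurable M"
    and lim: "AE \<omega> in M. (\<lambda>n. Y n \<omega>) \<longlonglongrightarrow> X \<omega>"
    and le: "\<forall>\<^sub>F n in sequentially. err (Y n) \<le> K"
  shows "err X \<le> K"
proof -
  \<comment> \<open>Needed because \<open>e2ennreal\<close> would truncate a negative
    \<open>K\<close> to 0.\<close>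
  have K: "0 \<le> K"
    using eventually_happens[OF le] by (auto intro: order_trans[OF err_nonneg])
  have "AE \<omega> in M. e2ennreal (e (X \<omega>)) \<le> liminf (\<lambda>n. e2ennreal (e (Y n \<omega>)))"
    using lim
  proof eventually_elim
    case (elim \<omega>)
    show ?case
      unfolding le_Liminf_iff
    proof (intro allI impI)
      fix y assume "y < e2ennreal (e (X \<omega>))"
      then have "enn2ereal y < e (X \<omega>)"
        by (simp add: less_ennreal.rep_eq enn2ereal_e2ennreal)
      also note lsc[OF elim]
      finally have "\<forall>\<^sub>F n in sequentially. enn2ereal y < e (Y n \<omega>)"
        by (rule less_LiminfD)
      then show "\<forall>\<^sub>F n in sequentially. y < e2ennreal (e (Y n \<omega>))"
        by eventually_elim (simp add: less_ennreal.rep_eq enn2ereal_e2ennreal)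
    qed
  qed
  then have "(\<integral>\<^sup>+ \<omega>. e2ennreal (e (X \<omega>)) \<partial>M) \<le> (\<integral>\<^sup>+ \<omega>. liminf (\<lambda>n. e2ennreal (e (Y n \<omega>))) \<partial>M)"
    by (rule nn_integral_mono_AE)
  also have "\<dots> \<le> liminf (\<lambda>n. \<integral>\<^sup>+ \<omega>. e2ennreal (e (Y n \<omega>)) \<partial>M)"
    by (rule nn_integral_liminf) measurable
  also have "\<dots> \<le> e2ennreal K"
  proof (rule Liminf_le)
    show "\<forall>\<^sub>F n in sequentially. (\<integral>\<^sup>+ \<omega>. e2ennreal (e (Y n \<omega>)) \<partial>M) \<le> e2ennreal K"
      using le by eventually_elim
        (use K in \<open>auto simp: err_eq_nn_integral less_eq_ennreal.rep_eq enn2ereal_e2ennreal\<close>)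
  qed simp
  finally show ?thesis
    using K by (simp add: err_eq_nn_integral less_eq_ennreal.rep_eq enn2ereal_e2ennreal)
qed

text \<open>Finite expected error allows \<open>e (Z \<omega>)\<close> to be replaced by an
  integrable real function, so that differences can be formed without meeting
  \<open>\<infinity> - \<infinity>\<close>.\<close>

lemma err_finite:
  assumes [measurable]: "Z \<in> borel_measurable M" and fin: "err Z < \<infinity>"
  shows "AE \<omega> in M. e (Z \<omega>) = ereal (real_of_ereal (e (Z \<omega>)))"
    and "integrable M (\<lambda>\<omega>. real_of_ereal (e (Z \<omega>)))"
    and "err Z = ereal (\<integral>\<omega>. real_of_ereal (e (Z \<omega>)) \<partial>M)"
proof -
  have int: "(\<integral>\<^sup>+ \<omega>. e2ennreal (e (Z \<omega>)) \<partial>M) \<noteq> \<infinity>"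
    using fin by (auto simp: err_eq_nn_integral)
  have "AE \<omega> in M. e2ennreal (e (Z \<omega>)) \<noteq> \<infinity>"
    by (rule nn_integral_noteq_infinite[OF _ int]) measurable
  then show AE: "AE \<omega> in M. e (Z \<omega>) = ereal (real_of_ereal (e (Z \<omega>)))"
  proof eventually_elim
    case (elim \<omega>)
    then show ?case by (cases "Z \<omega>" rule: finite_cases) auto
  qed
  have "AE \<omega> in M. e2ennreal (e (Z \<omega>)) = ennreal (real_of_ereal (e (Z \<omega>)))"
    using AE by eventually_elim (metis e2ennreal_ereal)
  then have "(\<integral>\<^sup>+ \<omega>. e2ennreal (e (Z \<omega>)) \<partial>M) = (\<integral>\<^sup>+ \<omega>. ennreal (real_of_ereal (e (Z \<omega>))) \<partial>M)"
    by (rule nn_integral_cong_AE)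
  with int show int': "integrable M (\<lambda>\<omega>. real_of_ereal (e (Z \<omega>)))"
    by (intro integrableI_nonneg) (auto simp: real_of_ereal_pos top.not_eq_extremum)
  show "err Z = ereal (\<integral>\<omega>. real_of_ereal (e (Z \<omega>)) \<partial>M)"
    unfolding ext_expectation_integrable[OF int', symmetric] err_def
    by (rule ext_expectation_cong_AE[OF AE])
qed

lemma err_coercive:
  obtains k m where "0 < k" "\<And>Z. integrable M Z \<Longrightarrow> ereal (k * (\<integral>\<omega>. \<bar>Z \<omega>\<bar> \<partial>M) - m) \<le> err Z"
proof -
  obtain k m where k: "0 < k" and km: "\<And>x. ereal (k * \<bar>x\<bar> - m) \<le> e x"
    using growth by blast
  have "ereal (k * (\<integral>\<omega>. \<bar>Z \<omega>\<bar> \<partial>M) - m) \<le> err Z" if Z: "integrable M Z" for Z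
  proof -
    have "ereal (k * (\<integral>\<omega>. \<bar>Z \<omega>\<bar> \<partial>M) - m) = ext_expectation M (\<lambda>\<omega>. ereal (k * \<bar>Z \<omega>\<bar> - m))"
      using Z by (subst ext_expectation_integrable) (auto simp: prob_space)
    also have "\<dots> \<le> err Z"
      unfolding err_def by (intro ext_expectation_mono_AE AE_I2 km)
    finally show ?thesis .
  qed
  then show thesis using that k by blast
qed

lemma err_attains_min:
  assumes X: "integrable M X"
  obtains C where "\<And>C'. err (\<lambda>\<omega>. X \<omega> - C) \<le> err (\<lambda>\<omega>. X \<omega> - C')"
proof (cases "\<forall>C. err (\<lambda>\<omega>. X \<omega> - C) = \<infinity>")
  case True
  then show thesis using that by simp
next
  case False
  have [measurable]: "X \<in> borel_measurable M" using X by auto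
  define m where "m = (INF C. err (\<lambda>\<omega>. X \<omega> - C))"
  have "0 \<le> m"
    by (auto simp: m_def intro!: INF_greatest)
  moreover have "m < \<infinity>"
    unfolding m_def INF_less_iff using False by auto
  ultimately obtain r where r: "m = ereal r" by (cases m) auto
  \<comment> \<open>Sublevel sets at height \<open>1 / Suc n\<close> above the infimum: nested,
    closed and nonempty, with \<open>S 0\<close> bounded. A common point is a minimizer.\<close>
  define S where "S n = {C. err (\<lambda>\<omega>. X \<omega> - C) \<le> ereal (r + 1 / real (Suc n))}" for n
  have "\<exists>C. \<forall>n. C \<in> S n"
  proof (rule bounded_closed_nest)
    show "closed (S n)" for n
      unfolding closed_sequential_limits
    proof (intro allI impI, elim conjE)
      fix x l assume x: "\<forall>n'. x n' \<in> S n" and l: "x \<longlonglongrightarrow> l"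
      have "err (\<lambda>\<omega>. X \<omega> - l) \<le> ereal (r + 1 / real (Suc n))"
      proof (rule err_le_of_AE_tendsto[where Y = "\<lambda>n \<omega>. X \<omega> - x n"])
        show "AE \<omega> in M. (\<lambda>n. X \<omega> - x n) \<longlonglongrightarrow> X \<omega> - l"
          by (intro AE_I2 tendsto_intros l)
        show "\<forall>\<^sub>F n' in sequentially. err (\<lambda>\<omega>. X \<omega> - x n') \<le> ereal (r + 1 / real (Suc n))"
          using x by (auto simp: S_def)
      qed simp
      then show "l \<in> S n" by (simp add: S_def)
    qed
    show "S n \<noteq> {}" for n
    proof -
      have "m < ereal (r + 1 / real (Suc n))" by (simp add: r)
      then obtain C where "err (\<lambda>\<omega>. X \<omega> - C) < ereal (r + 1 / real (Suc n))"
        unfolding m_def INF_less_iff by blast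
      then show ?thesis by (auto simp: S_def intro: less_imp_le)
    qed
    show "S n \<subseteq> S k" if "k \<le> n" for k n
    proof -
      have "ereal (r + 1 / real (Suc n)) \<le> ereal (r + 1 / real (Suc k))"
        using that by (simp add: frac_le)
      then show ?thesis by (auto simp: S_def intro: order_trans)
    qed
    obtain k K where k: "0 < k" "\<And>Z. integrable M Z \<Longrightarrow> ereal (k * (\<integral>\<omega>. \<bar>Z \<omega>\<bar> \<partial>M) - K) \<le> err Z"
      using err_coercive by blast
    show "bounded (S 0)"
      unfolding bounded_iff
    proof (intro exI ballI)
      fix C assume "C \<in> S 0"
      then have 0: "err (\<lambda>\<omega>. X \<omega> - C) \<le> ereal (r + 1)" by (simp add: S_def)
      have "ereal (k * (\<integral>\<omega>. \<bar>X \<omega> - C\<bar> \<partial>M) - K) \<le> err (\<lambda>\<omega>. X \<omega> - C)"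
        using X by (intro k(2)) simp
      from order_trans[OF this 0]
      have 1: "k * (\<integral>\<omega>. \<bar>X \<omega> - C\<bar> \<partial>M) \<le> r + 1 + K" by simp
      \<comment> \<open>The reverse triangle inequality converts the bound on the mean of
        \<open>\<bar>X - C\<bar>\<close> into a bound on \<open>\<bar>C\<bar>\<close>.\<close>
      have "\<bar>C\<bar> - (\<integral>\<omega>. \<bar>X \<omega>\<bar> \<partial>M) = (\<integral>\<omega>. \<bar>C\<bar> - \<bar>X \<omega>\<bar> \<partial>M)"
        using X by (simp add: prob_space)
      also have "\<dots> \<le> (\<integral>\<omega>. \<bar>X \<omega> - C\<bar> \<partial>M)"
        using X by (intro integral_mono) auto
      also have "\<dots> \<le> (r + 1 + K) / k"
        using 1 k(1) by (simp add: field_simps)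
      finally show "norm C \<le> (r + 1 + K) / k + (\<integral>\<omega>. \<bar>X \<omega>\<bar> \<partial>M)" by simp
    qed
  qed blast
  then obtain C where C: "\<And>n. err (\<lambda>\<omega>. X \<omega> - C) \<le> ereal (r + 1 / real (Suc n))"
    by (auto simp: S_def)
  have "(\<lambda>n. ereal (r + 1 / real (Suc n))) \<longlonglongrightarrow> ereal (r + 0)"
    using LIMSEQ_inverse_real_of_nat by (intro tendsto_intros) (simp add: inverse_eq_divide)
  then have "err (\<lambda>\<omega>. X \<omega> - C) \<le> ereal (r + 0)"
    by (rule LIMSEQ_le_const) (use C in blast)
  then have "err (\<lambda>\<omega>. X \<omega> - C) \<le> err (\<lambda>\<omega>. X \<omega> - C')" for C'
    using INF_lower[of C' UNIV "\<lambda>C. err (\<lambda>\<omega>. X \<omega> - C)"] r by (simp add: m_def)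
  then show thesis by (rule that)
qed

section \<open>Minimality expressed by one-sided derivatives\<close>

lemma left_deriv_expectation_le_0_iff:
  assumes [measurable]: "X \<in> borel_measurable M"
    and C1: "C < C1" "err (\<lambda>\<omega>. X \<omega> - C1) < \<infinity>"
  shows "ext_expectation M (\<lambda>\<omega>. left_deriv e (X \<omega> - C)) \<le> 0 \<longleftrightarrow>
    (\<forall>C'>C. err (\<lambda>\<omega>. X \<omega> - C) \<le> err (\<lambda>\<omega>. X \<omega> - C'))"
proof
  assume le: "ext_expectation M (\<lambda>\<omega>. left_deriv e (X \<omega> - C)) \<le> 0"
  show "\<forall>C'>C. err (\<lambda>\<omega>. X \<omega> - C) \<le> err (\<lambda>\<omega>. X \<omega> - C')"
  proof (intro allI impI)
    fix C' assume C': "C < C'"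
    show "err (\<lambda>\<omega>. X \<omega> - C) \<le> err (\<lambda>\<omega>. X \<omega> - C')"
    proof (cases "err (\<lambda>\<omega>. X \<omega> - C') < \<infinity>")
      case True
      note fin = err_finite[OF _ True, simplified]
      let ?g = "\<lambda>\<omega>. real_of_ereal (e (X \<omega> - C'))"
      have "AE \<omega> in M. e (X \<omega> - C) \<le> ereal (?g \<omega>) + ereal (C' - C) * left_deriv e (X \<omega> - C)"
        using fin(1)
      proof eventually_elim
        case (elim \<omega>)
        then have "e (X \<omega> - C') < \<infinity>"
          by (cases "X \<omega> - C'" rule: finite_cases) auto
        from le_left_deriv[OF this, of "X \<omega> - C"] elim C' show ?case by simp
      qed
      then have "err (\<lambda>\<omega>. X \<omega> - C) \<le>
          ext_expectation M (\<lambda>\<omega>. ereal (?g \<omega>) + ereal (C' - C) * left_deriv e (X \<omega> - C))"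
        unfolding err_def by (rule ext_expectation_mono_AE)
      also have "\<dots> = err (\<lambda>\<omega>. X \<omega> - C') +
          ereal (C' - C) * ext_expectation M (\<lambda>\<omega>. left_deriv e (X \<omega> - C))"
        using C' by (simp add: ext_expectation_add_integrable' fin(2,3) ext_expectation_cmult)
      also have "\<dots> \<le> err (\<lambda>\<omega>. X \<omega> - C') + ereal (C' - C) * 0"
        using le C' by (intro add_left_mono ereal_mult_left_mono) auto
      finally show ?thesis by simp
    qed simp
  qed
next
  assume min: "\<forall>C'>C. err (\<lambda>\<omega>. X \<omega> - C) \<le> err (\<lambda>\<omega>. X \<omega> - C')"
  \<comment> \<open>The first step has length \<open>C1 - C\<close>, so that
    \<open>Y 0 = X - C1\<close> has finite error by hypothesis.\<close>
  define h where "h n = (C1 - C) / real (Suc n)" for n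
  define Z where "Z \<omega> = X \<omega> - C" for \<omega>
  define Y where "Y n \<omega> = Z \<omega> - h n" for n \<omega>
  have [measurable]: "Z \<in> borel_measurable M"
    unfolding Z_def by measurable
  have [measurable]: "Y n \<in> borel_measurable M" for n
    unfolding Y_def by measurable
  have h: "0 < h n" "h n \<le> h 0" for n
    using C1(1) by (auto simp: h_def intro!: divide_left_mono mult_pos_pos simp del: of_nat_Suc)
  have h_lim: "h \<longlonglongrightarrow> 0"
    unfolding h_def
    using LIMSEQ_inverse_real_of_nat[THEN tendsto_mult_left[of _ _ _ "C1 - C"]]
    by (simp add: divide_inverse)
  have Z_le: "err Z \<le> err (Y n)" for n
    using min[rule_format, of "C + h n"] h(1)[of n] by (simp add: Z_def[abs_def] Y_def[abs_def] algebra_simps)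
  have Y0: "err (Y 0) < \<infinity>"
    using C1(2) by (simp add: Y_def[abs_def] Z_def[abs_def] h_def)
  have Z: "err Z < \<infinity>"
    using Z_le[of 0] Y0 by (rule le_less_trans)
  \<comment> \<open>Each \<open>Y n\<close> lies on the segment from \<open>Z\<close> to
    \<open>Y 0\<close>, both of finite error; convexity does the rest.\<close>
  have Y: "err (Y n) < \<infinity>" for n
  proof (cases n)
    case (Suc k)
    define t where "t = 1 / real (Suc n)"
    have t: "0 < t" "t < 1" by (auto simp: t_def Suc)
    have "h n = t * h 0" by (simp add: h_def t_def)
    then have "Y n = (\<lambda>\<omega>. (1 - t) * Z \<omega> + t * Y 0 \<omega>)"
      by (auto simp: Y_def algebra_simps)
    then have "err (Y n) \<le> ereal (1 - t) * err Z + ereal t * err (Y 0)"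
      using err_convex[of Z "Y 0" t] t by simp
    also have "\<dots> < \<infinity>"
      using Z Y0 t err_nonneg[of Z] err_nonneg[of "Y 0"] by (cases "err Z"; cases "err (Y 0)") auto
    finally show ?thesis .
  qed (use Y0 in simp)
  note finZ = err_finite[OF _ Z, simplified] and finY = err_finite[OF _ Y, simplified]
  define q where "q n \<omega> = (real_of_ereal (e (Z \<omega>)) - real_of_ereal (e (Y n \<omega>))) / h n" for n \<omega>
  have [measurable]: "q n \<in> borel_measurable M" for n
    unfolding q_def by measurable
  have q_int: "integrable M (q n)" for n
    unfolding q_def using finZ(2) finY(2) by auto
  have q_le: "(\<integral>\<omega>. q n \<omega> \<partial>M) \<le> 0" for n
  proof -
    have "(\<integral>\<omega>. real_of_ereal (e (Z \<omega>)) \<partial>M) \<le> (\<integral>\<omega>. real_of_ereal (e (Y n \<omega>)) \<partial>M)"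
      using Z_le[of n] by (simp add: finZ(3) finY(3))
    then show ?thesis
      using finZ(2) finY(2) h(1)[of n] by (simp add: q_def divide_nonpos_pos)
  qed
  have AE_fin: "AE \<omega> in M. e (Z \<omega>) = ereal (real_of_ereal (e (Z \<omega>))) \<and>
      (\<forall>n. e (Y n \<omega>) = ereal (real_of_ereal (e (Y n \<omega>))))"
    using finZ(1) finY(1) by (simp add: AE_all_countable)
  let ?D = "\<lambda>\<omega>. left_deriv e (Z \<omega>)"
  \<comment> \<open>\<open>q n\<close> is the chord slope of \<open>e\<close> from \<open>Z\<close>
    back to \<open>Y n\<close>. Shorter steps give larger slopes, which makes the integrable
    \<open>q 0\<close> a common minorant of all \<open>q n\<close> and of the derivative.\<close>
  have AE_q: "AE \<omega> in M. (\<forall>n. q 0 \<omega> \<le> q n \<omega>) \<and> (\<lambda>n. ereal (q n \<omega>)) \<longlonglongrightarrow> ?D \<omega> \<and> ereal (q 0 \<omega>) \<le> ?D \<omega>"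
    using AE_fin
  proof eventually_elim
    case (elim \<omega>)
    have q: "quot (Z \<omega>) (Z \<omega> - h n) = ereal (q n \<omega>)" for n
      using quot_real[of "Z \<omega>" _ "Y n \<omega>"] elim h(1)[of n]
      by (simp add: q_def Y_def minus_divide_left)
    have Z: "e (Z \<omega>) < \<infinity>"
      using elim by (cases "Z \<omega>" rule: finite_cases) auto
    have "quot (Z \<omega>) (Z \<omega> - h 0) \<le> quot (Z \<omega>) (Z \<omega> - h n)" for n
      using h[of n] by (intro quot_mono Z) auto
    then have "q 0 \<omega> \<le> q n \<omega>" for n
      by (simp add: q)
    moreover have "(\<lambda>n. ereal (q n \<omega>)) \<longlonglongrightarrow> ?D \<omega>"
      using quot_sequence_tendsto[OF Z h_lim h(1)] by (simp add: q)
    moreover have "ereal (q 0 \<omega>) \<le> ?D \<omega>"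
      using quot_le_left_deriv[OF Z, of "Z \<omega> - h 0"] h(1)[of 0] by (simp add: q)
    ultimately show ?case by blast
  qed
  \<comment> \<open>Fatou's lemma requires nonnegative functions, so \<open>q 0\<close> is
    subtracted here and its integral added back at the end.\<close>
  let ?W = "\<lambda>\<omega>. ?D \<omega> - ereal (q 0 \<omega>)"
  have "AE \<omega> in M. e2ennreal (?W \<omega>) = liminf (\<lambda>n. ennreal (q n \<omega> - q 0 \<omega>))"
    using AE_q
  proof eventually_elim
    case (elim \<omega>)
    then have "(\<lambda>n. ereal (q n \<omega>) - ereal (q 0 \<omega>)) \<longlonglongrightarrow> ?W \<omega>"
      by (intro tendsto_diff_ereal_general tendsto_const) auto
    then have "(\<lambda>n. e2ennreal (ereal (q n \<omega>) - ereal (q 0 \<omega>))) \<longlonglongrightarrow> e2ennreal (?W \<omega>)"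
      by (rule tendsto_e2ennrealI)
    then show ?case by (simp add: lim_imp_Liminf)
  qed
  then have "(\<integral>\<^sup>+ \<omega>. e2ennreal (?W \<omega>) \<partial>M) = (\<integral>\<^sup>+ \<omega>. liminf (\<lambda>n. ennreal (q n \<omega> - q 0 \<omega>)) \<partial>M)"
    by (rule nn_integral_cong_AE)
  also have "\<dots> \<le> liminf (\<lambda>n. \<integral>\<^sup>+ \<omega>. ennreal (q n \<omega> - q 0 \<omega>) \<partial>M)"
    by (rule nn_integral_liminf) measurable
  \<comment> \<open>Minimality of \<open>C\<close> makes every \<open>q n\<close> have nonpositive
    mean, so \<open>q n - q 0\<close> has mean at most that of \<open>- q 0\<close>.\<close>
  also have "\<dots> \<le> ennreal (- (\<integral>\<omega>. q 0 \<omega> \<partial>M))"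
  proof (rule Liminf_le[OF _ always_eventually], simp, rule allI)
    fix n
    have "AE \<omega> in M. 0 \<le> q n \<omega> - q 0 \<omega>"
      using AE_q by eventually_elim simp
    then have "(\<integral>\<^sup>+ \<omega>. ennreal (q n \<omega> - q 0 \<omega>) \<partial>M) = ennreal (\<integral>\<omega>. q n \<omega> - q 0 \<omega> \<partial>M)"
      using q_int by (intro nn_integral_eq_integral) auto
    also have "\<dots> \<le> ennreal (- (\<integral>\<omega>. q 0 \<omega> \<partial>M))"
      using q_int q_le[of n] by (intro ennreal_leI) simp
    finally show "(\<integral>\<^sup>+ \<omega>. ennreal (q n \<omega> - q 0 \<omega>) \<partial>M) \<le> ennreal (- (\<integral>\<omega>. q 0 \<omega> \<partial>M))" .
  qed
  \<comment> \<open>The mean of \<open>- q 0\<close> is nonnegative, so \<open>ennreal\<close> has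
    not truncated it.\<close>
  finally have W: "enn2ereal (\<integral>\<^sup>+ \<omega>. e2ennreal (?W \<omega>) \<partial>M) \<le> ereal (- (\<integral>\<omega>. q 0 \<omega> \<partial>M))"
    using q_le[of 0] by (simp add: less_eq_ennreal.rep_eq ennreal.rep_eq max_def)
  have "AE \<omega> in M. 0 \<le> ?W \<omega>"
    using AE_q
  proof eventually_elim
    case (elim \<omega>)
    then show ?case by (cases "?D \<omega>") auto
  qed
  then have W': "ext_expectation M ?W \<le> ereal (- (\<integral>\<omega>. q 0 \<omega> \<partial>M))"
    using W by (simp add: ext_expectation_nonneg)
  have "?D \<omega> = ?W \<omega> + ereal (q 0 \<omega>)" for \<omega>
    by (cases "?D \<omega>") auto
  then have "ext_expectation M ?D = ext_expectation M (\<lambda>\<omega>. ?W \<omega> + ereal (q 0 \<omega>))"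
    by simp
  also have "\<dots> = ext_expectation M ?W + ereal (\<integral>\<omega>. q 0 \<omega> \<partial>M)"
    by (rule ext_expectation_add_integrable) (use q_int in auto)
  also have "\<dots> \<le> ereal (- (\<integral>\<omega>. q 0 \<omega> \<partial>M)) + ereal (\<integral>\<omega>. q 0 \<omega> \<partial>M)"
    by (intro add_right_mono W')
  finally show "ext_expectation M (\<lambda>\<omega>. left_deriv e (X \<omega> - C)) \<le> 0"
    by (simp add: Z_def zero_ereal_def)
qed

text \<open>The reflected statement speaks of the expectation of \<open>- right_deriv e\<close>. The
  minus sign may be taken outside because \<open>right_deriv e (x - C)\<close> is at most
  \<open>e (x - C1) / h\<close> with \<open>h = C - C1\<close>, and this bound has finite
  expectation.\<close>

lemma right_deriv_expectation_ge_0_iff: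
  assumes [measurable]: "X \<in> borel_measurable M"
    and C1: "C1 < C" "err (\<lambda>\<omega>. X \<omega> - C1) < \<infinity>"
  shows "0 \<le> ext_expectation M (\<lambda>\<omega>. right_deriv e (X \<omega> - C)) \<longleftrightarrow>
    (\<forall>C'<C. err (\<lambda>\<omega>. X \<omega> - C) \<le> err (\<lambda>\<omega>. X \<omega> - C'))"
proof -
  interpret refl: error_integrand "\<lambda>x. e (- x)" by (rule reflect)
  interpret refl: expected_error M "\<lambda>x. e (- x)" ..
  have err: "refl.err (\<lambda>\<omega>. - X \<omega> - D) = err (\<lambda>\<omega>. X \<omega> - (- D))" for D
    by (simp add: refl.err_def err_def add.commute)
  define h where "h = C - C1"
  have h: "0 < h" using C1 by (simp add: h_def)
  have fin: "(\<integral>\<^sup>+ \<omega>. e2ennreal (e (X \<omega> - C1)) \<partial>M) < \<infinity>"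
    using C1(2) by (auto simp: err_eq_nn_integral top.not_eq_extremum[symmetric])
  \<comment> \<open>The supporting-line inequality at \<open>x - C\<close>, evaluated at the larger
    point \<open>x - C1\<close>, gives \<open>0 \<le> e (x - C) \<le> e (x - C1) - h * right_deriv e
    (x - C)\<close>.\<close>
  have "e2ennreal (right_deriv e (x - C)) \<le> ennreal (1 / h) * e2ennreal (e (x - C1))" for x
  proof (cases "x - C1" rule: finite_cases)
    case (1 r)
    have "e (x - C) \<le> ereal r + ereal h * left_deriv (\<lambda>x. e (- x)) (- (x - C))"
      using refl.le_left_deriv[of "- (x - C1)" "- (x - C)"] 1 C1(1) by (simp add: h_def)
    then have *: "0 \<le> ereal r + ereal h * - right_deriv e (x - C)"
      using order_trans[OF nonneg] by (simp add: right_deriv_eq)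
    show ?thesis
    proof (cases "right_deriv e (x - C)")
      case (real d)
      then have "h * d \<le> r" using * by simp
      then have "d \<le> 1 / h * r" using h by (simp add: field_simps)
      then show ?thesis
        using real 1 h by (simp flip: ennreal_mult add: ennreal_leI)
    next
      case PInf
      then show ?thesis using * h by simp
    qed (simp add: e2ennreal_neg)
  next
    case 2
    then show ?thesis using h by (simp add: ennreal_mult_top)
  qed
  then have "(\<integral>\<^sup>+ \<omega>. e2ennreal (right_deriv e (X \<omega> - C)) \<partial>M)
      \<le> (\<integral>\<^sup>+ \<omega>. ennreal (1 / h) * e2ennreal (e (X \<omega> - C1)) \<partial>M)"
    by (intro nn_integral_mono)
  also have "\<dots> = ennreal (1 / h) * (\<integral>\<^sup>+ \<omega>. e2ennreal (e (X \<omega> - C1)) \<partial>M)"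
    by (intro nn_integral_cmult) measurable
  also have "\<dots> < \<infinity>"
    using fin by (simp add: ennreal_mult_less_top)
  finally have "ext_expectation M (\<lambda>\<omega>. - right_deriv e (X \<omega> - C))
      = - ext_expectation M (\<lambda>\<omega>. right_deriv e (X \<omega> - C))"
    by (intro ext_expectation_uminus) auto
  then have "0 \<le> ext_expectation M (\<lambda>\<omega>. right_deriv e (X \<omega> - C)) \<longleftrightarrow>
      ext_expectation M (\<lambda>\<omega>. left_deriv (\<lambda>x. e (- x)) (- X \<omega> - (- C))) \<le> 0"
    by (simp add: right_deriv_eq ereal_uminus_le_reorder add.commute)
  also have "\<dots> \<longleftrightarrow> (\<forall>C'>- C. err (\<lambda>\<omega>. X \<omega> - C) \<le> err (\<lambda>\<omega>. X \<omega> - (- C')))"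
    using refl.left_deriv_expectation_le_0_iff[of "\<lambda>\<omega>. - X \<omega>" "- C" "- C1"] C1
    unfolding err by simp
  also have "\<dots> \<longleftrightarrow> (\<forall>C'<C. err (\<lambda>\<omega>. X \<omega> - C) \<le> err (\<lambda>\<omega>. X \<omega> - C'))"
    by (metis minus_less_iff minus_minus)
  finally show ?thesis .
qed

end

subsection \<open>Closed, convex and homogeneous functionals\<close>

text \<open>Along a convergent sequence the linear term is within any \<epsilon> of its limit, so
  the limit point stays in a slightly larger sublevel set of \<open>f\<close>; then \<epsilon> tends
  to 0. The slopes 1 and -1 give the passage between \<open>e\<close> and \<open>v\<close> in both
  directions.\<close>

lemma closed_fun_add_linear:
  assumes "closed_fun f"
  shows "closed_fun (\<lambda>x. f x + ereal (s * x))"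
  unfolding closed_fun_def closed_sequential_limits
proof (intro allI impI, elim conjE)
  fix C :: real and x l
  assume x: "\<forall>n. x n \<in> {x. f x + ereal (s * x) \<le> ereal C}" and l: "x \<longlonglongrightarrow> l"
  have le_iff: "f y + ereal (s * y) \<le> ereal D \<longleftrightarrow> f y \<le> ereal (D - s * y)" for y D
    by (cases "f y") auto
  have "f l \<le> ereal (C - s * l) + ereal \<epsilon>" if "0 < \<epsilon>" for \<epsilon>
  proof -
    have "(\<lambda>n. C - s * x n) \<longlonglongrightarrow> C - s * l"
      by (intro tendsto_intros l)
    then have "\<forall>\<^sub>F n in sequentially. C - s * x n < C - s * l + \<epsilon>"
      using that by (intro order_tendstoD) auto
    then have "\<forall>\<^sub>F n in sequentially. x n \<in> {y. f y \<le> ereal (C - s * l + \<epsilon>)}"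
    proof eventually_elim
      case (elim n)
      have "f (x n) \<le> ereal (C - s * x n)" using x by (simp add: le_iff)
      also have "\<dots> \<le> ereal (C - s * l + \<epsilon>)" using elim by simp
      finally show ?case by simp
    qed
    with l have "l \<in> {y. f y \<le> ereal (C - s * l + \<epsilon>)}"
      using assms by (intro Lim_in_closed_set[of _ x]) (auto simp: closed_fun_def)
    then show ?thesis by simp
  qed
  then have "f l \<le> ereal (C - s * l)"
    by (rule ereal_le_epsilon2) blast
  then show "l \<in> {x. f x + ereal (s * x) \<le> ereal C}" by (simp add: le_iff)
qed

lemma convex_fun_add_linear:
  assumes "convex_fun f"
  shows "convex_fun (\<lambda>x. f x + ereal (s * x))"
  unfolding convex_fun_def
proof (intro allI impI)
  fix x y t :: real assume t: "0 < t \<and> t < 1"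
  have "f ((1 - t) * x + t * y) + ereal (s * ((1 - t) * x + t * y))
      \<le> (ereal (1 - t) * f x + ereal t * f y) + ereal (s * ((1 - t) * x + t * y))"
    using assms t by (intro add_right_mono) (auto simp: convex_fun_def)
  also have "\<dots> = ereal (1 - t) * (f x + ereal (s * x)) + ereal t * (f y + ereal (s * y))"
    using t by (cases "f x"; cases "f y") (auto simp: algebra_simps)
  finally show "f ((1 - t) * x + t * y) + ereal (s * ((1 - t) * x + t * y))
      \<le> ereal (1 - t) * (f x + ereal (s * x)) + ereal t * (f y + ereal (s * y))" .
qed

lemma argmin_iff: "C \<in> argmin f \<longleftrightarrow> (\<forall>C'. f C \<le> f C')"
  by (auto simp: argmin_def is_arg_min_def not_less)

text \<open>A sublevel set with non-open complement contains a sequence converging in the seminorm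
  to a point outside it. This sequence converges in L^1, and a subsequence converges almost surely.
  Convergence of the means is recorded as well, for functionals that contain the expectation as a
  summand.\<close>

lemma (in prob_space) closed_functionalI:
  assumes p: "1 \<le> p"
    and lim: "\<And>X Y C. X \<in> Lp M p \<Longrightarrow> (\<And>n::nat. Y n \<in> Lp M p) \<Longrightarrow>
      AE \<omega> in M. (\<lambda>n. Y n \<omega>) \<longlonglongrightarrow> X \<omega> \<Longrightarrow>
      (\<lambda>n. \<integral>\<omega>. Y n \<omega> \<partial>M) \<longlonglongrightarrow> (\<integral>\<omega>. X \<omega> \<partial>M) \<Longrightarrow>
      (\<And>n. F (Y n) \<le> ereal C) \<Longrightarrow> F X \<le> ereal C"
  shows "closed_functional M p F"
  unfolding closed_functional_def
proof
  fix C :: real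
  let ?S = "{X \<in> Lp M p. F X \<le> ereal C}"
  have "openin (Lp_topology M p) (Lp M p)"
    unfolding openin_Lp_topology by (auto intro: exI[of _ 1])
  then have top: "topspace (Lp_topology M p) = Lp M p"
    by (metis openin_Lp_topology openin_topspace openin_subset subset_antisym)
  have "\<exists>r>0. \<forall>Y\<in>Lp M p. Lp_norm M p (\<lambda>\<omega>. Y \<omega> - X \<omega>) < ereal r \<longrightarrow> Y \<in> Lp M p - ?S"
    if X: "X \<in> Lp M p - ?S" for X
  proof (rule ccontr)
    assume *: "\<not> ?thesis"
    have "\<forall>n. \<exists>Y. Y \<in> Lp M p \<and> F Y \<le> ereal C \<and> Lp_norm M p (\<lambda>\<omega>. Y \<omega> - X \<omega>) < ereal (inverse (real (Suc n)))"
    proof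
      fix n
      have "0 < inverse (real (Suc n))" by simp
      with * show "\<exists>Y. Y \<in> Lp M p \<and> F Y \<le> ereal C \<and> Lp_norm M p (\<lambda>\<omega>. Y \<omega> - X \<omega>) < ereal (inverse (real (Suc n)))"
        by blast
    qed
    from choice[OF this] obtain Y where Y: "\<And>n. Y n \<in> Lp M p" "\<And>n. F (Y n) \<le> ereal C"
        "\<And>n. Lp_norm M p (\<lambda>\<omega>. Y n \<omega> - X \<omega>) < ereal (inverse (real (Suc n)))"
      by blast
    have Xi: "integrable M X" and Yi: "integrable M (Y n)" for n
      using X Y(1) integrable_Lp[OF p] by auto
    have bound: "(\<integral>\<omega>. norm (Y n \<omega> - X \<omega>) \<partial>M) \<le> 2 * inverse (real (Suc n))" for n
    proof -
      have "ennreal (\<integral>\<omega>. norm (Y n \<omega> - X \<omega>) \<partial>M) = (\<integral>\<^sup>+ \<omega>. ennreal \<bar>Y n \<omega> - X \<omega>\<bar> \<partial>M)"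
        using Xi Yi[of n] by (subst nn_integral_eq_integral) auto
      also have "\<dots> \<le> ennreal (2 * inverse (real (Suc n)))"
        by (rule nn_integral_abs_le_of_Lp_norm[OF p]) (use Y(3)[of n] Xi Yi in auto)
      finally show ?thesis by (simp add: ennreal_le_iff)
    qed
    have "(\<lambda>n. 2 * inverse (real (Suc n))) \<longlonglongrightarrow> 2 * 0"
      by (intro tendsto_mult_left LIMSEQ_inverse_real_of_nat)
    then have lim0: "(\<lambda>n. 2 * inverse (real (Suc n))) \<longlonglongrightarrow> 0"
      by simp
    have L1: "(\<lambda>n. \<integral>\<omega>. norm (Y n \<omega> - X \<omega>) \<partial>M) \<longlonglongrightarrow> 0"
    proof (rule Lim_null_comparison[OF always_eventually lim0], rule allI)
      show "norm (\<integral>\<omega>. norm (Y n \<omega> - X \<omega>) \<partial>M) \<le> 2 * inverse (real (Suc n))" for n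
        using bound[of n] by (simp only: real_norm_def abs_of_nonneg Bochner_Integration.integral_nonneg norm_ge_zero)
    qed
    obtain r where r: "strict_mono r" "AE \<omega> in M. (\<lambda>n. Y (r n) \<omega> - X \<omega>) \<longlonglongrightarrow> 0"
      using tendsto_L1_AE_subseq[OF Bochner_Integration.integrable_diff[OF Yi Xi] L1] by blast
    have "(\<lambda>n. (\<integral>\<omega>. Y n \<omega> \<partial>M) - (\<integral>\<omega>. X \<omega> \<partial>M)) \<longlonglongrightarrow> 0"
    proof (rule Lim_null_comparison[OF _ L1], rule always_eventually, rule allI)
      show "norm ((\<integral>\<omega>. Y n \<omega> \<partial>M) - (\<integral>\<omega>. X \<omega> \<partial>M)) \<le> (\<integral>\<omega>. norm (Y n \<omega> - X \<omega>) \<partial>M)" for n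
        using Xi Yi[of n] integral_norm_bound[of M "\<lambda>\<omega>. Y n \<omega> - X \<omega>"] by simp
    qed
    then have "(\<lambda>n. \<integral>\<omega>. Y n \<omega> \<partial>M) \<longlonglongrightarrow> (\<integral>\<omega>. X \<omega> \<partial>M)"
      by (rule LIM_zero_cancel)
    then have "(\<lambda>n. \<integral>\<omega>. Y (r n) \<omega> \<partial>M) \<longlonglongrightarrow> (\<integral>\<omega>. X \<omega> \<partial>M)"
      using LIMSEQ_subseq_LIMSEQ[OF _ r(1)] by (force simp: o_def)
    moreover have "AE \<omega> in M. (\<lambda>n. Y (r n) \<omega>) \<longlonglongrightarrow> X \<omega>"
      using r(2) by eventually_elim (rule LIM_zero_cancel)
    ultimately have "F X \<le> ereal C"
      using X Y by (intro lim[of X "\<lambda>n. Y (r n)"]) auto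
    then show False using X by simp
  qed
  then show "closedin (Lp_topology M p) ?S"
    unfolding closedin_def top openin_Lp_topology by auto
qed

lemma two_linear_pieces_of_homogeneous:
  assumes hom: "\<And>c x. 0 < c \<Longrightarrow> f (c * x) = ereal c * f x" and "f 0 = 0"
  shows "two_linear_pieces f"
  unfolding two_linear_pieces_def
proof (intro conjI exI allI impI)
  show "f 0 = 0" by fact
  \<comment> \<open>For \<open>x < 0\<close> homogeneity gives \<open>f x = - x * f (- 1)\<close>.
    Moving the sign into the slope turns the value \<open>f (- 1) = \<infinity>\<close> into the
    slope \<open>-\<infinity>\<close>.\<close>
  show "f x = (- f (- 1)) * ereal x" if "x < 0" for x
    using hom[of "- x" "- 1"] that by (cases "f (- 1)") auto
  show "f x = f 1 * ereal x" if "0 < x" for x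
    using hom[of x 1] that by (simp add: mult.commute)
qed

lemma homogeneous_of_two_linear_pieces:
  assumes f: "two_linear_pieces f" and c: "0 < c"
  shows "f (c * x) = ereal c * f x"
proof -
  obtain a b where a: "\<And>x. x < 0 \<Longrightarrow> f x = a * ereal x" and b: "\<And>x. 0 < x \<Longrightarrow> f x = b * ereal x"
    and "f 0 = 0"
    using f by (auto simp: two_linear_pieces_def)
  consider "x < 0" | "x = 0" | "0 < x" by linarith
  then show ?thesis
  proof cases
    case 1
    then have "c * x < 0" using c by (simp add: mult_pos_neg)
    then show ?thesis using 1 by (simp add: a mult.left_commute flip: times_ereal.simps(1))
  next
    case 3
    then have "0 < c * x" using c by simp
    then show ?thesis using 3 by (simp add: b mult.left_commute flip: times_ereal.simps(1))
  qed (simp add: \<open>f 0 = 0\<close>)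
qed

subsection \<open>Regret and the quadrangle\<close>

context expected_error
begin

definition regret :: "('a \<Rightarrow> real) \<Rightarrow> ereal" where
  "regret X = ext_expectation M (\<lambda>\<omega>. ereal (X \<omega>) + e (X \<omega>))"

lemma regret_eq:
  assumes X: "integrable M X"
  shows "regret X = err X + ereal (\<integral>\<omega>. X \<omega> \<partial>M)"
proof -
  have [measurable]: "X \<in> borel_measurable M" using X by auto
  show ?thesis
    unfolding regret_def err_def
    by (subst ext_expectation_add_integrable') (auto simp: X add.commute)
qed

lemma regret_const: "regret (\<lambda>_. c) = ereal c + e c"
  by (simp add: regret_eq err_const prob_space add.commute)

text \<open>Otherwise \<open>e (Suc n * X)\<close> vanishes almost surely for each \<open>n\<close>,
  and the countably many null sets combine into one. Off it, linear growth of \<open>e\<close> along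
  the integer multiples of \<open>X \<omega>\<close> forces \<open>X \<omega> = 0\<close>.\<close>

lemma err_scale_pos:
  assumes [measurable]: "X \<in> borel_measurable M" and X: "\<not> (AE \<omega> in M. X \<omega> = 0)"
  shows "\<exists>c>0. 0 < err (\<lambda>\<omega>. c * X \<omega>)"
proof (rule ccontr)
  assume *: "\<not> ?thesis"
  have "AE \<omega> in M. e (real (Suc n) * X \<omega>) = 0" for n
  proof -
    have "err (\<lambda>\<omega>. real (Suc n) * X \<omega>) \<le> 0"
      using * by (meson not_le of_nat_0_less_iff zero_less_Suc)
    then have "(\<integral>\<^sup>+ \<omega>. e2ennreal (e (real (Suc n) * X \<omega>)) \<partial>M) = 0"
      using err_nonneg[of "\<lambda>\<omega>. real (Suc n) * X \<omega>"]
      by (metis antisym err_eq_nn_integral e2ennreal_enn2ereal e2ennreal_neg order_refl)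
    then have "AE \<omega> in M. e2ennreal (e (real (Suc n) * X \<omega>)) = 0"
      by (subst (asm) nn_integral_0_iff_AE) auto
    then show ?thesis
      by eventually_elim (metis enn2ereal_e2ennreal nonneg zero_ennreal.rep_eq)
  qed
  then have AE: "AE \<omega> in M. \<forall>n. e (real (Suc n) * X \<omega>) = 0"
    by (simp add: AE_all_countable)
  obtain k m where k: "0 < k" and km: "\<And>x. ereal (k * \<bar>x\<bar> - m) \<le> e x"
    using growth by blast
  have "AE \<omega> in M. X \<omega> = 0"
    using AE
  proof eventually_elim
    case (elim \<omega>)
    show ?case
    proof (rule ccontr)
      assume "X \<omega> \<noteq> 0"
      then have pos: "0 < k * \<bar>X \<omega>\<bar>" using k by simp
      then obtain n where n: "m < real n * (k * \<bar>X \<omega>\<bar>)"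
        using reals_Archimedean3 by blast
      have "ereal (k * \<bar>real (Suc n) * X \<omega>\<bar> - m) \<le> 0"
        using km[of "real (Suc n) * X \<omega>"] elim by simp
      then have "k * (real (Suc n) * \<bar>X \<omega>\<bar>) \<le> m"
        by (simp add: abs_mult del: of_nat_Suc)
      with n pos show False by (simp add: algebra_simps)
    qed
  qed
  with X show False ..
qed

lemma subregular_error_err:
  assumes p: "1 \<le> p"
  shows "subregular_error M p err"
  unfolding subregular_error_def
proof (intro conjI ballI impI)
  have meas: "X \<in> borel_measurable M" if "X \<in> Lp M p" for X
    using that by (simp add: Lp_def)
  show "respects_AE M p err"
    by (auto simp: respects_AE_def intro: err_cong_AE)
  show "closed_functional M p err"
  proof (rule closed_functionalI[OF p])
    fix X Y C assume "AE \<omega> in M. (\<lambda>n::nat. Y n \<omega>) \<longlonglongrightarrow> X \<omega>"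
      "\<And>n. Y n \<in> Lp M p" "\<And>n. err (Y n) \<le> ereal C"
    then show "err X \<le> ereal C"
      by (intro err_le_of_AE_tendsto[of Y]) (auto intro: meas)
  qed
  show "convex_functional M p err"
    by (auto simp: convex_functional_def intro!: err_convex meas)
  show "err (\<lambda>_. 0) = 0" by (simp add: err_const)
  show "\<exists>c>0. 0 < err (\<lambda>\<omega>. c * X \<omega>)" if "X \<in> Lp M p" "\<not> (AE \<omega> in M. X \<omega> = 0)" for X
    using that by (intro err_scale_pos meas)
qed simp

lemma subregular_regret_regret:
  assumes p: "1 \<le> p"
  shows "subregular_regret M p regret"
  unfolding subregular_regret_def
proof (intro conjI ballI impI)
  note int = integrable_Lp[OF p]
  have meas: "X \<in> borel_measurable M" if "X \<in> Lp M p" for X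
    using that by (simp add: Lp_def)
  show "respects_AE M p regret"
    unfolding respects_AE_def regret_def
  proof (intro ballI impI ext_expectation_cong_AE)
    fix X Y :: "'a \<Rightarrow> real" assume "AE \<omega> in M. X \<omega> = Y \<omega>"
    then show "AE \<omega> in M. ereal (X \<omega>) + e (X \<omega>) = ereal (Y \<omega>) + e (Y \<omega>)"
      by eventually_elim simp
  qed
  show ge: "ereal (integral\<^sup>L M X) \<le> regret X" if "X \<in> Lp M p" for X
    using err_nonneg[of X] by (cases "err X") (auto simp: regret_eq[OF int[OF that]])
  show "regret X \<noteq> -\<infinity>" if "X \<in> Lp M p" for X
    using ge[OF that] by auto
  show "closed_functional M p regret"
  proof (rule closed_functionalI[OF p])
    fix X Y C assume X: "X \<in> Lp M p" and Y: "\<And>n::nat. Y n \<in> Lp M p"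
      and lim: "AE \<omega> in M. (\<lambda>n. Y n \<omega>) \<longlonglongrightarrow> X \<omega>"
        "(\<lambda>n. \<integral>\<omega>. Y n \<omega> \<partial>M) \<longlonglongrightarrow> (\<integral>\<omega>. X \<omega> \<partial>M)"
      and le: "\<And>n. regret (Y n) \<le> ereal C"
    have le_iff: "regret Z \<le> ereal D \<longleftrightarrow> err Z \<le> ereal (D - (\<integral>\<omega>. Z \<omega> \<partial>M))" if "Z \<in> Lp M p" for Z D
      by (cases "err Z") (auto simp: regret_eq[OF int[OF that]])
    \<comment> \<open>The bound on \<open>err (Y n)\<close> moves with the mean of
      \<open>Y n\<close>; eventually that mean exceeds the mean of \<open>X\<close> minus
      \<epsilon>, which gives the fixed bound that the Fatou argument requires.\<close>
    have "err X \<le> ereal (C - (\<integral>\<omega>. X \<omega> \<partial>M)) + ereal \<epsilon>" if "0 < \<epsilon>" for \<epsilon>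
    proof (rule err_le_of_AE_tendsto[OF _ lim(1)])
      have "\<forall>\<^sub>F n in sequentially. (\<integral>\<omega>. X \<omega> \<partial>M) - \<epsilon> < (\<integral>\<omega>. Y n \<omega> \<partial>M)"
        using that by (intro order_tendstoD(1)[OF lim(2)]) simp
      then show "\<forall>\<^sub>F n in sequentially. err (Y n) \<le> ereal (C - (\<integral>\<omega>. X \<omega> \<partial>M)) + ereal \<epsilon>"
      proof eventually_elim
        case (elim n)
        have "err (Y n) \<le> ereal (C - (\<integral>\<omega>. Y n \<omega> \<partial>M))"
          using le Y le_iff by simp
        also have "\<dots> \<le> ereal (C - (\<integral>\<omega>. X \<omega> \<partial>M)) + ereal \<epsilon>"
          using elim by simp
        finally show ?case .
      qed
      show "Y n \<in> borel_measurable M" for n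
        by (rule meas[OF Y])
    qed
    then show "regret X \<le> ereal C"
      unfolding le_iff[OF X] by (rule ereal_le_epsilon2) blast
  qed
  show "convex_functional M p regret"
    unfolding convex_functional_def
  proof (intro ballI allI impI)
    fix X Y t assume X: "X \<in> Lp M p" and Y: "Y \<in> Lp M p" and t: "0 < t \<and> t < (1::real)"
    have "err (\<lambda>\<omega>. (1 - t) * X \<omega> + t * Y \<omega>) \<le> ereal (1 - t) * err X + ereal t * err Y"
      using t X Y by (intro err_convex meas) auto
    then have "err (\<lambda>\<omega>. (1 - t) * X \<omega> + t * Y \<omega>) + ereal (\<integral>\<omega>. (1 - t) * X \<omega> + t * Y \<omega> \<partial>M)
        \<le> (ereal (1 - t) * err X + ereal t * err Y) + ereal (\<integral>\<omega>. (1 - t) * X \<omega> + t * Y \<omega> \<partial>M)"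
      by (rule add_right_mono)
    also have "\<dots> = ereal (1 - t) * (err X + ereal (\<integral>\<omega>. X \<omega> \<partial>M)) + ereal t * (err Y + ereal (\<integral>\<omega>. Y \<omega> \<partial>M))"
      using t int[OF X] int[OF Y] by (cases "err X"; cases "err Y") (auto simp: algebra_simps)
    finally show "regret (\<lambda>\<omega>. (1 - t) * X \<omega> + t * Y \<omega>) \<le> ereal (1 - t) * regret X + ereal t * regret Y"
      using int[OF X] int[OF Y] by (simp add: regret_eq)
  qed
  show "regret (\<lambda>_. 0) = 0" by (simp add: regret_const)
  show "\<exists>c>0. ereal (integral\<^sup>L M (\<lambda>\<omega>. c * X \<omega>)) < regret (\<lambda>\<omega>. c * X \<omega>)"
    if X: "X \<in> Lp M p" "\<not> (AE \<omega> in M. X \<omega> = 0)" for X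
  proof -
    obtain c where c: "0 < c" "0 < err (\<lambda>\<omega>. c * X \<omega>)"
      using err_scale_pos[OF meas X(2)] X(1) by blast
    then have "ereal (integral\<^sup>L M (\<lambda>\<omega>. c * X \<omega>)) < regret (\<lambda>\<omega>. c * X \<omega>)"
      using int[OF X(1)] by (cases "err (\<lambda>\<omega>. c * X \<omega>)") (auto simp: regret_eq)
    then show ?thesis using c(1) by blast
  qed
qed

lemma dom_functional_regret:
  assumes "1 \<le> p"
  shows "dom_functional M p regret = dom_functional M p err"
proof -
  have "regret X < \<infinity> \<longleftrightarrow> err X < \<infinity>" if "X \<in> Lp M p" for X
    using regret_eq[OF integrable_Lp[OF assms that]] by (cases "err X") auto
  then show ?thesis by (auto simp: dom_functional_def)
qed

text \<open>The two objectives in \<open>C\<close> differ by the mean of \<open>X\<close>, which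
  does not depend on \<open>C\<close>. Hence they share their minimizers, and risk differs from
  deviation by that mean.\<close>

lemma regret_shift:
  assumes "integrable M X"
  shows "ereal C + regret (\<lambda>\<omega>. X \<omega> - C) = err (\<lambda>\<omega>. X \<omega> - C) + ereal (\<integral>\<omega>. X \<omega> \<partial>M)"
  using assms by (cases "err (\<lambda>\<omega>. X \<omega> - C)") (auto simp: regret_eq prob_space)

lemma risk_of_regret:
  assumes "integrable M X"
  shows "risk_of regret X = deviation_of err X + ereal (\<integral>\<omega>. X \<omega> \<partial>M)"
  unfolding risk_of_def deviation_of_def regret_shift[OF assms]
  by (intro INF_ereal_add_left) auto

lemma statistic_of_err_eq_regret:
  assumes "integrable M X"
  shows "statistic_of err X = argmin (\<lambda>C. ereal C + regret (\<lambda>\<omega>. X \<omega> - C))"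
proof -
  have "a + ereal c \<le> b + ereal c \<longleftrightarrow> a \<le> b" for a b c
    by (cases a; cases b) auto
  then show ?thesis
    unfolding statistic_of_def regret_shift[OF assms] by (auto simp: argmin_iff)
qed

lemma statistic_of_err_nonempty:
  assumes "integrable M X"
  shows "statistic_of err X \<noteq> {}"
  using err_attains_min[OF assms] by (metis argmin_iff empty_iff statistic_of_def)

lemma deviation_of_err_eq:
  assumes "C \<in> statistic_of err X"
  shows "deviation_of err X = err (\<lambda>\<omega>. X \<omega> - C)"
  using assms unfolding deviation_of_def statistic_of_def argmin_iff
  by (intro antisym INF_lower INF_greatest) auto

text \<open>The replacement by \<open>-\<infinity>\<close> takes effect precisely if the expected
  error is infinite at every \<open>C' > C\<close>, and then minimality against these
  \<open>C'\<close> is trivial. In all other cases a finite value to the right of \<open>C\<close>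
  is available.\<close>

lemma left_deriv_condition:
  assumes p: "1 \<le> p" and X: "X \<in> Lp M p"
  shows "(if C_plus M p regret X \<le> ereal C then -\<infinity>
      else ext_expectation M (\<lambda>\<omega>. left_deriv e (X \<omega> - C))) \<le> 0 \<longleftrightarrow>
    (\<forall>C'>C. err (\<lambda>\<omega>. X \<omega> - C) \<le> err (\<lambda>\<omega>. X \<omega> - C'))"
proof (cases "\<exists>C1>C. err (\<lambda>\<omega>. X \<omega> - C1) < \<infinity>")
  case True
  then have "\<not> C_plus M p regret X \<le> ereal C"
    unfolding C_plus_def dom_functional_regret[OF p] not_le less_Sup_iff
    using Lp_diff_const[OF p X] by (force simp: dom_functional_def)
  then show ?thesis
    using True left_deriv_expectation_le_0_iff[of X C] X by (auto simp: Lp_def)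
next
  case False
  have "C_plus M p regret X \<le> ereal C"
    unfolding C_plus_def dom_functional_regret[OF p]
  proof (rule Sup_least, clarify)
    fix C1 assume "(\<lambda>\<omega>. X \<omega> - C1) \<in> dom_functional M p err"
    then show "ereal C1 \<le> ereal C"
      using False by (auto simp: dom_functional_def not_less)
  qed
  then show ?thesis using False by auto
qed

lemma right_deriv_condition:
  assumes p: "1 \<le> p" and X: "X \<in> Lp M p"
  shows "0 \<le> (if ereal C \<le> C_minus M p regret X then \<infinity>
      else ext_expectation M (\<lambda>\<omega>. right_deriv e (X \<omega> - C))) \<longleftrightarrow>
    (\<forall>C'<C. err (\<lambda>\<omega>. X \<omega> - C) \<le> err (\<lambda>\<omega>. X \<omega> - C'))"
proof (cases "\<exists>C1<C. err (\<lambda>\<omega>. X \<omega> - C1) < \<infinity>")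
  case True
  then have "\<not> ereal C \<le> C_minus M p regret X"
    unfolding C_minus_def dom_functional_regret[OF p] not_le Inf_less_iff
    using Lp_diff_const[OF p X] by (force simp: dom_functional_def)
  then show ?thesis
    using True right_deriv_expectation_ge_0_iff[of X _ C] X by (auto simp: Lp_def)
next
  case False
  have "ereal C \<le> C_minus M p regret X"
    unfolding C_minus_def dom_functional_regret[OF p]
  proof (rule Inf_greatest, clarify)
    fix C1 assume "(\<lambda>\<omega>. X \<omega> - C1) \<in> dom_functional M p err"
    then show "ereal C \<le> ereal C1"
      using False by (auto simp: dom_functional_def not_less)
  qed
  then show ?thesis using False by auto
qed

lemma statistic_of_err_deriv:
  assumes p: "1 \<le> p" and X: "X \<in> Lp M p"
  shows "statistic_of err X =
    {C. (if C_plus M p regret X \<le> ereal C then -\<infinity>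
         else ext_expectation M (\<lambda>\<omega>. left_deriv e (X \<omega> - C))) \<le> 0 \<and>
        0 \<le> (if ereal C \<le> C_minus M p regret X then \<infinity>
         else ext_expectation M (\<lambda>\<omega>. right_deriv e (X \<omega> - C)))}"
  unfolding left_deriv_condition[OF assms] right_deriv_condition[OF assms]
  by (auto simp: statistic_of_def argmin_iff) (metis linorder_less_linear order_refl)

text \<open>On a probability space a summand 1 in the derivative raises its expectation by 1, which
  moves the threshold from 0 to 1 and leaves the infinite replacements unaffected.\<close>

lemma statistic_of_err_deriv_regret:
  assumes p: "1 \<le> p" and X: "X \<in> Lp M p"
  shows "statistic_of err X =
    {C. (if C_plus M p regret X \<le> ereal C then -\<infinity>
         else ext_expectation M (\<lambda>\<omega>. left_deriv (\<lambda>x. ereal x + e x) (X \<omega> - C))) \<le> 1 \<and>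
        1 \<le> (if ereal C \<le> C_minus M p regret X then \<infinity>
         else ext_expectation M (\<lambda>\<omega>. right_deriv (\<lambda>x. ereal x + e x) (X \<omega> - C)))}"
proof -
  have [measurable]: "X \<in> borel_measurable M" using X by (simp add: Lp_def)
  have add1: "ext_expectation M (\<lambda>\<omega>. f \<omega> + 1) = ext_expectation M f + 1"
    if "f \<in> borel_measurable M" for f
    using ext_expectation_add_integrable[OF that, of "\<lambda>_. 1"] by (simp add: prob_space one_ereal_def)
  have "a + 1 \<le> 1 \<longleftrightarrow> a \<le> 0" "1 \<le> a + 1 \<longleftrightarrow> 0 \<le> a" for a :: ereal
    by (cases a; simp add: one_ereal_def)+
  then show ?thesis
    unfolding statistic_of_err_deriv[OF assms] left_deriv_add_id right_deriv_add_id
    by (simp add: add1)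
qed

lemma regret_integrand_mono:
  assumes nonpos: "\<And>x. x < 0 \<Longrightarrow> ereal x + e x \<le> 0" and xy: "x \<le> y"
  shows "ereal x + e x \<le> ereal y + e y"
proof (cases "0 \<le> y")
  case True
  have y: "0 \<le> ereal y + e y"
    using True by (intro add_nonneg_nonneg) auto
  show ?thesis
  proof (cases "x < 0")
    case True
    then show ?thesis using nonpos y order_trans by blast
  next
    case False
    then have "e x \<le> e y" using xy by (intro mono_outward) auto
    then show ?thesis using xy by (intro add_mono) auto
  qed
next
  case False
  have fin: "\<exists>r. e z = ereal r \<and> r \<le> - z" if "z < 0" for z
    using nonpos[OF that] by (cases z rule: finite_cases) auto
  obtain r s where r: "e x = ereal r" and s: "e y = ereal s"
    using fin False xy by (metis le_less_trans not_le)
  show ?thesis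
  proof (rule ccontr)
    assume "\<not> ?thesis"
    then have gt: "y + s < x + r" by (simp add: r s)
    then have "x < y" using xy r s by (cases "x = y") auto
    define d where "d = (x + r) - (y + s)"
    have d: "0 < d" using gt by (simp add: d_def)
    txt \<open>By convexity the line through \<open>x\<close> and \<open>y\<close> bounds \<open>ereal z + e z\<close> from below to the left
      of \<open>x\<close>; at this \<open>z\<close> it has risen from \<open>x + r\<close> to \<open>1\<close> or more.\<close>
    define n where "n = max 1 ((1 - (x + r)) / d)"
    have n: "1 \<le> n" "1 - (x + r) \<le> n * d"
      using d by (auto simp: n_def pos_divide_le_eq[symmetric])
    define z where "z = x - n * (y - x)"
    have "0 < n * (y - x)" using n \<open>x < y\<close> by simp
    then have z: "z < 0" using \<open>x < y\<close> False by (simp add: z_def)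
    obtain q where q: "e z = ereal q" "q \<le> - z" using fin[OF z] by blast
    define t where "t = 1 / (1 + n)"
    have t: "0 < t" "t \<le> 1" "t * (1 + n) = 1" using n by (auto simp: t_def)
    have "(1 - t) * y + t * z = y - (t * (1 + n)) * (y - x)"
      by (simp add: z_def algebra_simps)
    then have comb: "(1 - t) * y + t * z = x" using t(3) by simp
    have "r \<le> (1 - t) * s + t * q"
      using convexD[of t y z] t comb by (simp add: r s q)
    then have "x + r \<le> (1 - t) * (y + s) + t * (z + q)"
      using comb by (simp add: algebra_simps)
    also have "\<dots> \<le> (1 - t) * (y + s)"
      using q(2) t by (simp add: mult_le_0_iff)
    finally have "(1 + n) * (x + r) \<le> (1 + n) * ((1 - t) * (y + s))"
      using n by (intro mult_left_mono) auto
    also have "\<dots> = (1 + n - t * (1 + n)) * (y + s)"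
      by (simp add: algebra_simps)
    also have "\<dots> = n * (y + s)" unfolding t(3) by simp
    finally have "x + r + n * d \<le> 0"
      by (simp add: d_def algebra_simps)
    with n show False by simp
  qed
qed

lemma monotone_iff:
  assumes p: "1 \<le> p"
  shows "monotone_functional M p regret \<and> monotone_functional M p (risk_of regret) \<longleftrightarrow>
    (\<forall>x<0. ereal x + e x \<le> 0)"
proof
  assume mono: "monotone_functional M p regret \<and> monotone_functional M p (risk_of regret)"
  show "\<forall>x<0. ereal x + e x \<le> 0"
  proof (intro allI impI)
    fix x :: real assume "x < 0"
    \<comment> \<open>On constants the regret is its integrand, so testing with constants recovers
      the pointwise condition.\<close>
    then have "regret (\<lambda>_. x) \<le> regret (\<lambda>_. 0)"
      using mono const_Lp by (simp add: monotone_functional_def)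
    then show "ereal x + e x \<le> 0" by (simp add: regret_const zero_ereal_def)
  qed
next
  assume nonpos: "\<forall>x<0. ereal x + e x \<le> 0"
  have mono: "regret X \<le> regret Y" if "AE \<omega> in M. X \<omega> \<le> Y \<omega>" for X Y
    unfolding regret_def
  proof (rule ext_expectation_mono_AE)
    show "AE \<omega> in M. ereal (X \<omega>) + e (X \<omega>) \<le> ereal (Y \<omega>) + e (Y \<omega>)"
      using that by eventually_elim (simp add: regret_integrand_mono nonpos)
  qed
  have "risk_of regret X \<le> risk_of regret Y" if "AE \<omega> in M. X \<omega> \<le> Y \<omega>" for X Y
    unfolding risk_of_def using that by (intro INF_mono' add_left_mono mono) auto
  with mono show "monotone_functional M p regret \<and> monotone_functional M p (risk_of regret)"
    by (auto simp: monotone_functional_def)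
qed

lemma pos_homogeneous_iff:
  assumes p: "1 \<le> p"
  shows "pos_homogeneous M p (risk_of regret) \<and> pos_homogeneous M p (deviation_of err) \<and>
      pos_homogeneous M p regret \<and> pos_homogeneous M p err \<longleftrightarrow>
    two_linear_pieces (\<lambda>x. ereal x + e x) \<and> two_linear_pieces e"
proof
  assume hom: "pos_homogeneous M p (risk_of regret) \<and> pos_homogeneous M p (deviation_of err) \<and>
      pos_homogeneous M p regret \<and> pos_homogeneous M p err"
  show "two_linear_pieces (\<lambda>x. ereal x + e x) \<and> two_linear_pieces e"
  proof (intro conjI two_linear_pieces_of_homogeneous)
    fix c x :: real assume c: "0 < c"
    \<comment> \<open>Again constants suffice: there \<open>regret\<close> and \<open>err\<close>
      reduce to \<open>v\<close> and \<open>e\<close>.\<close>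
    have scale: "F (\<lambda>_. c * x) = ereal c * F (\<lambda>_. x)" if "pos_homogeneous M p F" for F
      using that[unfolded pos_homogeneous_def, rule_format, OF const_Lp c] .
    have "regret (\<lambda>_. c * x) = ereal c * regret (\<lambda>_. x)" "err (\<lambda>_. c * x) = ereal c * err (\<lambda>_. x)"
      using hom by (blast intro: scale)+
    then show "ereal (c * x) + e (c * x) = ereal c * (ereal x + e x)" "e (c * x) = ereal c * e x"
      unfolding regret_const err_const .
  qed auto
next
  assume "two_linear_pieces (\<lambda>x. ereal x + e x) \<and> two_linear_pieces e"
  then have e: "e (c * x) = ereal c * e x" if "0 < c" for c x
    using that homogeneous_of_two_linear_pieces by blast
  note int = integrable_Lp[OF p]
  have err: "err (\<lambda>\<omega>. c * X \<omega>) = ereal c * err X"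
    if [measurable]: "X \<in> borel_measurable M" and "0 < c" for X c
    using that(2) unfolding err_def by (simp add: e ext_expectation_cmult)
  have dist: "ereal c * (a + ereal r) = ereal c * a + ereal (c * r)" if "0 < c" for c a r
    using that by (cases a) (auto simp: algebra_simps)
  have dev: "deviation_of err (\<lambda>\<omega>. c * X \<omega>) = ereal c * deviation_of err X"
    if X [measurable]: "X \<in> borel_measurable M" and c: "0 < c" for X c
  proof -
    \<comment> \<open>The infimum is reparametrized by \<open>C = c * D\<close>, which runs through
      the whole line since \<open>c > 0\<close>.\<close>
    have "deviation_of err (\<lambda>\<omega>. c * X \<omega>) = (INF D. err (\<lambda>\<omega>. c * X \<omega> - c * D))"
      unfolding deviation_of_def
    proof (rule INF_eq)
      show "\<exists>D\<in>UNIV. err (\<lambda>\<omega>. c * X \<omega> - c * D) \<le> err (\<lambda>\<omega>. c * X \<omega> - C)" for C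
        using c by (intro bexI[of _ "C / c"]) auto
    qed blast
    also have "\<dots> = (INF D. ereal c * err (\<lambda>\<omega>. X \<omega> - D))"
      using c by (simp add: right_diff_distrib[symmetric] err)
    also have "range (\<lambda>D. ereal c * err (\<lambda>\<omega>. X \<omega> - D)) =
        {ereal c * x |x. x \<in> range (\<lambda>D. err (\<lambda>\<omega>. X \<omega> - D))}"
      by auto
    also have "Inf \<dots> = ereal c * deviation_of err X"
      using ereal_Inf_cmult[OF c, of "\<lambda>x. x \<in> range (\<lambda>D. err (\<lambda>\<omega>. X \<omega> - D))"]
      by (simp add: deviation_of_def)
    finally show ?thesis .
  qed
  have "pos_homogeneous M p err"
    by (auto simp: pos_homogeneous_def Lp_def err)
  moreover have "pos_homogeneous M p (deviation_of err)"
    by (auto simp: pos_homogeneous_def Lp_def dev)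
  moreover have "pos_homogeneous M p regret"
    unfolding pos_homogeneous_def
  proof (intro ballI allI impI)
    fix X and c :: real assume X: "X \<in> Lp M p" and c: "0 < c"
    show "regret (\<lambda>\<omega>. c * X \<omega>) = ereal c * regret X"
      using int[OF X] c by (simp add: regret_eq err dist borel_measurable_integrable)
  qed
  moreover have "pos_homogeneous M p (risk_of regret)"
    unfolding pos_homogeneous_def
  proof (intro ballI allI impI)
    fix X and c :: real assume X: "X \<in> Lp M p" and c: "0 < c"
    show "risk_of regret (\<lambda>\<omega>. c * X \<omega>) = ereal c * risk_of regret X"
      using int[OF X] c by (simp add: risk_of_regret dev dist borel_measurable_integrable)
  qed
  ultimately show "pos_homogeneous M p (risk_of regret) \<and> pos_homogeneous M p (deviation_of err) \<and>
      pos_homogeneous M p regret \<and> pos_homogeneous M p err" by blast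
qed

end

theorem theorem19:
  fixes M :: "'a measure" and p :: ennreal
    and e v :: "real \<Rightarrow> ereal"
    and \<V> \<E> :: "('a \<Rightarrow> real) \<Rightarrow> ereal"
  assumes "prob_space M" and "1 \<le> p"
    and "\<forall>x. 0 \<le> e x" and "\<forall>x. v x \<noteq> -\<infinity>"
    and "\<forall>x. e x = v x - ereal x" and "\<forall>x. v x = ereal x + e x"
    and "\<V> = (\<lambda>X. ext_expectation M (\<lambda>\<omega>. v (X \<omega>)))"
    and "\<E> = (\<lambda>X. ext_expectation M (\<lambda>\<omega>. e (X \<omega>)))"
  shows
    "((closed_fun e \<and> convex_fun e \<and> e 0 = 0 \<and> (\<forall>x. 0 \<le> e x) \<and>
         (\<exists>a b. a < 0 \<and> 0 < b \<and> 0 < e a \<and> 0 < e b))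
      \<longleftrightarrow>
      (closed_fun v \<and> convex_fun v \<and> v 0 = 0 \<and> (\<forall>x. ereal x \<le> v x) \<and>
         (\<exists>a b. a < 0 \<and> 0 < b \<and> ereal a < v a \<and> ereal b < v b)))
     \<and>
     ((closed_fun e \<and> convex_fun e \<and> e 0 = 0 \<and> (\<forall>x. 0 \<le> e x) \<and>
         (\<exists>a b. a < 0 \<and> 0 < b \<and> 0 < e a \<and> 0 < e b))
      \<longrightarrow>
        subregular_regret M p \<V> \<and> subregular_error M p \<E> \<and> corresponding_pair M p \<V> \<E> \<and>
        dom_functional M p \<V> = dom_functional M p \<E> \<and>
        (\<forall>X\<in>Lp M p.
           risk_of \<V> X = deviation_of \<E> X + ereal (integral\<^sup>L M X) \<and>
           statistic_of \<E> X = argmin (\<lambda>C. ereal C + \<V> (\<lambda>\<omega>. X \<omega> - C))) \<and>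
        (\<forall>X\<in>dom_functional M p \<V>.
           statistic_of \<E> X =
             {C. (if C_plus M p \<V> X \<le> ereal C then -\<infinity>
                  else ext_expectation M (\<lambda>\<omega>. left_deriv e (X \<omega> - C))) \<le> 0 \<and>
                 0 \<le> (if ereal C \<le> C_minus M p \<V> X then \<infinity>
                      else ext_expectation M (\<lambda>\<omega>. right_deriv e (X \<omega> - C)))} \<and>
           statistic_of \<E> X =
             {C. (if C_plus M p \<V> X \<le> ereal C then -\<infinity>
                  else ext_expectation M (\<lambda>\<omega>. left_deriv v (X \<omega> - C))) \<le> 1 \<and>
                 1 \<le> (if ereal C \<le> C_minus M p \<V> X then \<infinity>
                      else ext_expectation M (\<lambda>\<omega>. right_deriv v (X \<omega> - C)))}) \<and>
        (\<forall>X\<in>Lp M p. statistic_of \<E> X \<noteq> {} \<and>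
           (\<forall>C\<in>statistic_of \<E> X.
              deviation_of \<E> X = ext_expectation M (\<lambda>\<omega>. e (X \<omega> - C)) \<and>
              risk_of \<V> X = ereal C + ext_expectation M (\<lambda>\<omega>. v (X \<omega> - C)))) \<and>
        ((monotone_functional M p \<V> \<and> monotone_functional M p (risk_of \<V>))
           \<longleftrightarrow> (\<forall>x<0. v x \<le> 0)) \<and>
        ((\<forall>x<0. v x \<le> 0) \<longleftrightarrow> (\<forall>x<0. e x \<le> ereal \<bar>x\<bar>)) \<and>
        ((pos_homogeneous M p (risk_of \<V>) \<and> pos_homogeneous M p (deviation_of \<E>) \<and>
          pos_homogeneous M p \<V> \<and> pos_homogeneous M p \<E>)
           \<longleftrightarrow> (two_linear_pieces v \<and> two_linear_pieces e)))"
proof -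
  interpret prob_space M by fact
  note p = \<open>1 \<le> p\<close>
  have v_eq: "v = (\<lambda>x. ereal x + e x)" and e_nonneg: "\<And>x. 0 \<le> e x"
    using assms(3,6) by auto
  let ?i = "closed_fun e \<and> convex_fun e \<and> e 0 = 0 \<and> (\<forall>x. 0 \<le> e x) \<and>
      (\<exists>a b. a < 0 \<and> 0 < b \<and> 0 < e a \<and> 0 < e b)"
  \<comment> \<open>Each function is the other plus a linear term, of slope -1 or 1, so closedness
    and convexity pass in both directions.\<close>
  have "e = (\<lambda>x. v x + ereal (- 1 * x))" "v = (\<lambda>x. e x + ereal (1 * x))"
    using assms(5,6) by (auto simp: minus_ereal_def add.commute)
  then have closed: "closed_fun e \<longleftrightarrow> closed_fun v" and convex: "convex_fun e \<longleftrightarrow> convex_fun v"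
    using closed_fun_add_linear convex_fun_add_linear by metis+
  have pointwise: "e x = 0 \<longleftrightarrow> v x = ereal x" "0 < e x \<longleftrightarrow> ereal x < v x" "ereal x \<le> v x"
    "v x \<le> 0 \<longleftrightarrow> e x \<le> ereal (- x)" for x
    using e_nonneg[of x] by (cases "e x"; auto simp: v_eq)+
  have "e 0 = 0 \<longleftrightarrow> v 0 = 0"
    using pointwise(1)[of 0] by (simp add: zero_ereal_def)
  then have equiv: "?i \<longleftrightarrow> closed_fun v \<and> convex_fun v \<and> v 0 = 0 \<and> (\<forall>x. ereal x \<le> v x) \<and>
         (\<exists>a b. a < 0 \<and> 0 < b \<and> ereal a < v a \<and> ereal b < v b)"
    using e_nonneg by (simp add: closed convex pointwise(2,3))
  have neg: "(\<forall>x<0. v x \<le> 0) \<longleftrightarrow> (\<forall>x<0. e x \<le> ereal \<bar>x\<bar>)"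
    by (auto simp: pointwise(4))
  show ?thesis
  proof (intro conjI[OF equiv] impI)
    assume i: ?i
    interpret error_integrand e
      using i by unfold_locales auto
    interpret expected_error M e ..
    have V: "\<V> = regret" and E: "\<E> = err"
      by (simp_all add: assms(7,8) v_eq regret_def[abs_def] err_def[abs_def])
    note int = integrable_Lp[OF p]
    have dom: "X \<in> Lp M p" if "X \<in> dom_functional M p regret" for X
      using that by (simp add: dom_functional_def)
    show "subregular_regret M p \<V> \<and> subregular_error M p \<E> \<and> corresponding_pair M p \<V> \<E> \<and>
        dom_functional M p \<V> = dom_functional M p \<E> \<and>
        (\<forall>X\<in>Lp M p.
           risk_of \<V> X = deviation_of \<E> X + ereal (integral\<^sup>L M X) \<and>
           statistic_of \<E> X = argmin (\<lambda>C. ereal C + \<V> (\<lambda>\<omega>. X \<omega> - C))) \<and>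
        (\<forall>X\<in>dom_functional M p \<V>.
           statistic_of \<E> X =
             {C. (if C_plus M p \<V> X \<le> ereal C then -\<infinity>
                  else ext_expectation M (\<lambda>\<omega>. left_deriv e (X \<omega> - C))) \<le> 0 \<and>
                 0 \<le> (if ereal C \<le> C_minus M p \<V> X then \<infinity>
                      else ext_expectation M (\<lambda>\<omega>. right_deriv e (X \<omega> - C)))} \<and>
           statistic_of \<E> X =
             {C. (if C_plus M p \<V> X \<le> ereal C then -\<infinity>
                  else ext_expectation M (\<lambda>\<omega>. left_deriv v (X \<omega> - C))) \<le> 1 \<and>
                 1 \<le> (if ereal C \<le> C_minus M p \<V> X then \<infinity>
                      else ext_expectation M (\<lambda>\<omega>. right_deriv v (X \<omega> - C)))}) \<and>
        (\<forall>X\<in>Lp M p. statistic_of \<E> X \<noteq> {} \<and>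
           (\<forall>C\<in>statistic_of \<E> X.
              deviation_of \<E> X = ext_expectation M (\<lambda>\<omega>. e (X \<omega> - C)) \<and>
              risk_of \<V> X = ereal C + ext_expectation M (\<lambda>\<omega>. v (X \<omega> - C)))) \<and>
        ((monotone_functional M p \<V> \<and> monotone_functional M p (risk_of \<V>))
           \<longleftrightarrow> (\<forall>x<0. v x \<le> 0)) \<and>
        ((\<forall>x<0. v x \<le> 0) \<longleftrightarrow> (\<forall>x<0. e x \<le> ereal \<bar>x\<bar>)) \<and>
        ((pos_homogeneous M p (risk_of \<V>) \<and> pos_homogeneous M p (deviation_of \<E>) \<and>
          pos_homogeneous M p \<V> \<and> pos_homogeneous M p \<E>)
           \<longleftrightarrow> (two_linear_pieces v \<and> two_linear_pieces e))"
      unfolding V E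
    proof (intro conjI ballI)
      show "subregular_regret M p regret" "subregular_error M p err"
        by (fact subregular_regret_regret[OF p] subregular_error_err[OF p])+
      show "corresponding_pair M p regret err"
        by (simp add: corresponding_pair_def regret_eq int)
      show "dom_functional M p regret = dom_functional M p err"
        by (fact dom_functional_regret[OF p])
      show "risk_of regret X = deviation_of err X + ereal (integral\<^sup>L M X)"
        and "statistic_of err X = argmin (\<lambda>C. ereal C + regret (\<lambda>\<omega>. X \<omega> - C))"
        and "statistic_of err X \<noteq> {}" if "X \<in> Lp M p" for X
        by (fact risk_of_regret[OF int[OF that]] statistic_of_err_eq_regret[OF int[OF that]]
            statistic_of_err_nonempty[OF int[OF that]])+
      show "statistic_of err X =
          {C. (if C_plus M p regret X \<le> ereal C then -\<infinity>
               else ext_expectation M (\<lambda>\<omega>. left_deriv e (X \<omega> - C))) \<le> 0 \<and>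
              0 \<le> (if ereal C \<le> C_minus M p regret X then \<infinity>
                   else ext_expectation M (\<lambda>\<omega>. right_deriv e (X \<omega> - C)))}"
        and "statistic_of err X =
          {C. (if C_plus M p regret X \<le> ereal C then -\<infinity>
               else ext_expectation M (\<lambda>\<omega>. left_deriv v (X \<omega> - C))) \<le> 1 \<and>
              1 \<le> (if ereal C \<le> C_minus M p regret X then \<infinity>
                   else ext_expectation M (\<lambda>\<omega>. right_deriv v (X \<omega> - C)))}"
        if "X \<in> dom_functional M p regret" for X
        unfolding v_eq
        by (fact statistic_of_err_deriv[OF p dom[OF that]]
            statistic_of_err_deriv_regret[OF p dom[OF that]])+
      show "deviation_of err X = ext_expectation M (\<lambda>\<omega>. e (X \<omega> - C))"
        and "risk_of regret X = ereal C + ext_expectation M (\<lambda>\<omega>. v (X \<omega> - C))"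
        if "X \<in> Lp M p" "C \<in> statistic_of err X" for X C
      proof -
        show "deviation_of err X = ext_expectation M (\<lambda>\<omega>. e (X \<omega> - C))"
          unfolding deviation_of_err_eq[OF that(2)] err_def ..
        \<comment> \<open>At a minimizer the deviation is attained, and the shift identity at the
          same \<open>C\<close> turns it into the risk.\<close>
        show "risk_of regret X = ereal C + ext_expectation M (\<lambda>\<omega>. v (X \<omega> - C))"
          using regret_shift[OF int[OF that(1)], of C]
          by (simp add: risk_of_regret[OF int[OF that(1)]] deviation_of_err_eq[OF that(2)]
              regret_def v_eq)
      qed
      show "monotone_functional M p regret \<and> monotone_functional M p (risk_of regret)
          \<longleftrightarrow> (\<forall>x<0. v x \<le> 0)"
        unfolding v_eq by (fact monotone_iff[OF p])
      show "(\<forall>x<0. v x \<le> 0) \<longleftrightarrow> (\<forall>x<0. e x \<le> ereal \<bar>x\<bar>)"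
        by (fact neg)
      show "pos_homogeneous M p (risk_of regret) \<and> pos_homogeneous M p (deviation_of err) \<and>
          pos_homogeneous M p regret \<and> pos_homogeneous M p err
          \<longleftrightarrow> two_linear_pieces v \<and> two_linear_pieces e"
        unfolding v_eq by (fact pos_homogeneous_iff[OF p])
    qed
  qed
qed

end
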